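(* For every finite Abelian group $L$ and every integer $r \geqslant 1$, letting $L^r_n = L \oplus C_n^r$ for integers $n \geqslant 1$ with $\exp(L) \mid n$, $$\mathsf{D}(L^r_n) \sim rn \quad \text{as } n \to +\infty \text{ with } \exp(L) \mid n,$$ i.e. $\mathsf{D}(L^r_n)/(rn) \to 1$ as $n \to +\infty$ along integers $n$ divisible by $\exp(L)$.
   Context: For an integer $n \geqslant 1$, $C_n$ denotes the cyclic group of order $n$ and $C_n^r$ the direct sum of $r$ copies of $C_n$. For a finite Abelian group $G$, $\exp(G)$ is its exponent. A sequence over $G$ is a finite (unordered, repetitions allowed) sequence of elements of $G$; it is zero-sum if the sum of its elements is $0$. The Davenport constant $\mathsf{D}(G)$ is the smallest integer $t \geqslant 1$ such that every sequence over $G$ of length at least $t$ contains a non-empty zero-sum subsequence. *)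

theory Defs
  imports Complex_Main "HOL-Library.Multiset" "HOL-Algebra.Algebra"
begin

text \<open>Abelian groups are written multiplicatively: the group operation is \<^term>\<open>mult G\<close>,
  and "zero" means the neutral element \<^term>\<open>one G\<close>.\<close>

definition group_exponent :: "('a, 'b) monoid_scheme \<Rightarrow> nat" where
  "group_exponent G = (LEAST e. e \<ge> 1 \<and> (\<forall>x\<in>carrier G. x [^]\<^bsub>G\<^esub> e = \<one>\<^bsub>G\<^esub>))"

text \<open>A sequence over \<open>G\<close> is a finite multiset of elements of \<^term>\<open>carrier G\<close>; subsequences are
  submultisets. The sum of the terms is formed with repetitions.\<close>

definition seq_sum :: "('a, 'b) monoid_scheme \<Rightarrow> 'a multiset \<Rightarrow> 'a" where
  "seq_sum G S = finprod G (\<lambda>x. x [^]\<^bsub>G\<^esub> count S x) (set_mset S)"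

definition zero_sum :: "('a, 'b) monoid_scheme \<Rightarrow> 'a multiset \<Rightarrow> bool" where
  "zero_sum G S \<longleftrightarrow> seq_sum G S = \<one>\<^bsub>G\<^esub>"

definition davenport :: "('a, 'b) monoid_scheme \<Rightarrow> nat" where
  "davenport G = (LEAST t. t \<ge> 1 \<and>
     (\<forall>S. set_mset S \<subseteq> carrier G \<and> size S \<ge> t \<longrightarrow>
        (\<exists>T. T \<subseteq># S \<and> T \<noteq> {#} \<and> zero_sum G T)))"

definition cyclic_power :: "nat \<Rightarrow> nat \<Rightarrow> (nat \<Rightarrow> int) monoid" where
  "cyclic_power n r = product_group {..<r} (\<lambda>_. integer_mod_group n)"

end

theory Submission
  imports Defs "HOL-Library.FuncSet"
begin

text \<open>
  Lower bound: in \<open>C\<^sub>n\<^sup>r\<close>, repeat each of the \<open>r\<close> basis elements \<open>n - 1\<close> times.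

  Upper bound: let \<open>q\<close> be the largest prime power exactly dividing \<open>n\<close> and put \<open>n = q m\<close>; then
  \<open>q \<longrightarrow> \<infinity>\<close> with \<open>n\<close>. From a long sequence one repeatedly extracts disjoint blocks of length \<open>m\<close>
  whose sums vanish modulo \<open>m\<close>. The block sums essentially live in a \<open>p\<close>-group of type
  \<open>C\<^sub>q\<^sup>r\<close> plus a bounded part, so by Olson's theorem about \<open>r q\<close> blocks suffice, which costs
  \<open>r q m = r n\<close> terms. What is left when no further block can be extracted must be \<open>o(n)\<close>. For this
  it suffices that, for primes \<open>p\<close>, every sequence of at least \<open>C p\<^sup>3\<^sup>/\<^sup>2\<close> vectors modulo \<open>p\<close> contains
  a zero-sum subsequence of length exactly \<open>p\<close>; the bound is propagated to composite \<open>m\<close> by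
  peeling off prime factors.

  The prime case is a weak form of the theorem of Alon and Dubiner, by induction on the dimension.
  If many terms lie on one affine hyperplane, drop a coordinate. Otherwise a Fourier argument shows
  that some pair of terms \<open>a, b\<close> enlarges a set \<open>Y\<close> of subsums of size at most half the space to
  \<open>(Y + a) \<union> (Y + b)\<close>, larger by a factor \<open>1 + 1/(4K)\<close> with \<open>K\<close> of order \<open>p / log p\<close>, so that
  \<open>p / 2\<close> such steps fill more than half of the space.
\<close>

hide_const (open) Divisibility.prime

section \<open>Differences modulo a prime\<close>

text \<open>Modulo \<open>p\<close> this says that \<open>f\<close> behaves like a polynomial of
  degree less than \<open>d\<close>: all \<open>d\<close>-fold differences, in arbitrary directions,
  vanish.\<close>

fun vanishing_diffs :: "nat \<Rightarrow> nat \<Rightarrow> (('i \<Rightarrow> int) \<Rightarrow> int) \<Rightarrow> bool" where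
  "vanishing_diffs p 0 f \<longleftrightarrow> (\<forall>x. int p dvd f x)"
| "vanishing_diffs p (Suc d) f \<longleftrightarrow>
     (\<forall>v. vanishing_diffs p d (\<lambda>x. f (\<lambda>i. x i + v i) - f x))"

lemma vanishing_diffs_zero:
  "(\<And>x. int p dvd f x) \<Longrightarrow> vanishing_diffs p d f"
  by (induction d arbitrary: f) auto

lemma vanishing_diffs_add:
  "vanishing_diffs p d f \<Longrightarrow> vanishing_diffs p d g \<Longrightarrow> vanishing_diffs p d (\<lambda>x. f x + g x)"
proof (induction d arbitrary: f g)
  case (Suc d)
  have "(\<lambda>x. f (\<lambda>i. x i + v i) + g (\<lambda>i. x i + v i) - (f x + g x)) =
        (\<lambda>x. (f (\<lambda>i. x i + v i) - f x) + (g (\<lambda>i. x i + v i) - g x))" for v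
    by (auto simp: algebra_simps)
  then show ?case using Suc by simp
qed auto

lemma vanishing_diffs_uminus:
  "vanishing_diffs p d f \<Longrightarrow> vanishing_diffs p d (\<lambda>x. - f x)"
proof (induction d arbitrary: f)
  case (Suc d)
  show ?case unfolding vanishing_diffs.simps
  proof
    fix v
    have "vanishing_diffs p d (\<lambda>x. f (\<lambda>i. x i + v i) - f x)" using Suc.prems by simp
    from Suc.IH[OF this]
    show "vanishing_diffs p d (\<lambda>x. - f (\<lambda>i. x i + v i) - - f x)" by simp
  qed
qed auto

lemma vanishing_diffs_shift:
  "vanishing_diffs p d f \<Longrightarrow> vanishing_diffs p d (\<lambda>x. f (\<lambda>i. x i + w i))"
proof (induction d arbitrary: f)
  case (Suc d)
  show ?case unfolding vanishing_diffs.simps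
  proof
    fix v
    have "vanishing_diffs p d (\<lambda>x. f (\<lambda>i. x i + v i) - f x)" using Suc.prems by simp
    from Suc.IH[OF this] show "vanishing_diffs p d
       (\<lambda>x. f (\<lambda>i. x i + v i + w i) - f (\<lambda>i. x i + w i))"
      by (simp add: add.commute add.left_commute)
  qed
qed auto

text \<open>Degrees at most \<open>a\<close> and \<open>b\<close> give degree at most
  \<open>a + b\<close>. The product rule writes a difference of \<open>f * g\<close> as two products
  of smaller total degree.\<close>

lemma vanishing_diffs_mult:
  "vanishing_diffs p (Suc a) f \<Longrightarrow> vanishing_diffs p (Suc b) g \<Longrightarrow>
   vanishing_diffs p (Suc (a + b)) (\<lambda>x. f x * g x)"
proof (induction "a + b" arbitrary: a b f g rule: less_induct)
  case less
  show ?case unfolding vanishing_diffs.simps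
  proof
    fix v
    let ?f = "\<lambda>x. f (\<lambda>i. x i + v i)"
    let ?df = "\<lambda>x. f (\<lambda>i. x i + v i) - f x"
    let ?dg = "\<lambda>x. g (\<lambda>i. x i + v i) - g x"
    have df: "vanishing_diffs p a ?df" and dg: "vanishing_diffs p b ?dg"
      using less.prems by auto
    have f: "vanishing_diffs p (Suc a) ?f" by (rule vanishing_diffs_shift[OF less.prems(1)])
    have 1: "vanishing_diffs p (a + b) (\<lambda>x. ?f x * ?dg x)"
    \<comment> \<open>For \<open>b = 0\<close> the difference of \<open>g\<close> is already
      divisible by \<open>p\<close> at every point, so the induction hypothesis is needed only for
      positive \<open>b\<close>.\<close>
    proof (cases b)
      case 0
      then show ?thesis using dg by (intro vanishing_diffs_zero) auto
    next
      case (Suc b')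
      then show ?thesis using less.hyps[of a b' ?f ?dg] f dg by simp
    qed
    have 2: "vanishing_diffs p (a + b) (\<lambda>x. ?df x * g x)"
    proof (cases a)
      case 0
      then show ?thesis using df by (intro vanishing_diffs_zero) auto
    next
      case (Suc a')
      then show ?thesis using less.hyps[of a' b ?df g] less.prems(2) df by simp
    qed
    have "(\<lambda>x. f (\<lambda>i. x i + v i) * g (\<lambda>i. x i + v i) - f x * g x) =
          (\<lambda>x. ?f x * ?dg x + ?df x * g x)"
      by (auto simp: algebra_simps)
    with vanishing_diffs_add[OF 1 2]
    show "vanishing_diffs p (a + b) (\<lambda>x. f (\<lambda>i. x i + v i) * g (\<lambda>i. x i + v i) - f x * g x)"
      by simp
  qed
qed

lemma vanishing_diffs_prod:
  assumes "finite I" "\<And>i. i \<in> I \<Longrightarrow> vanishing_diffs p (Suc (a i)) (f i)"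
  shows "vanishing_diffs p (Suc (\<Sum>i\<in>I. a i)) (\<lambda>x. \<Prod>i\<in>I. f i x)"
  using assms
proof (induction I rule: finite_induct)
  case empty
  show ?case by simp
next
  case (insert j I)
  then show ?case using vanishing_diffs_mult[of p "a j" "f j" "sum a I"] by simp
qed

text \<open>Unit steps suffice: a difference of step \<open>c\<close> telescopes into shifted unit
  differences, which are subtracted when \<open>c\<close> is negative.\<close>

lemma vanishing_diffs_coordinate:
  assumes "\<And>s. int p dvd ((\<lambda>h s. h (s + 1) - h s) ^^ d) g s"
  shows "vanishing_diffs p d (\<lambda>x. g (x i))"
  using assms
proof (induction d arbitrary: g)
  case (Suc d)
  have 1: "vanishing_diffs p d (\<lambda>x. g (x i + 1) - g (x i))"
    using Suc.IH[of "\<lambda>s. g (s + 1) - g s"] Suc.prems by (simp add: funpow_Suc_right del: funpow.simps)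
  have shifted: "vanishing_diffs p d (\<lambda>x. g (x i + c + 1) - g (x i + c))" for c
    using vanishing_diffs_shift[OF 1, of "\<lambda>_. c"] by (simp add: add_ac)
  have "vanishing_diffs p d (\<lambda>x. g (x i + c) - g (x i))" for c
  proof (induction c rule: int_induct[where k = 0])
    case base
    show ?case by (simp add: vanishing_diffs_zero)
  next
    case (step1 c)
    from vanishing_diffs_add[OF step1(2) shifted[of c]] show ?case by (simp add: add_ac)
  next
    case (step2 c)
    from vanishing_diffs_add[OF step2(2) vanishing_diffs_uminus[OF shifted[of "c - 1"]]]
    show ?case by simp
  qed
  then show ?case by simp
qed auto

lemma iterated_difference:
  fixes g :: "int \<Rightarrow> int"
  shows "((\<lambda>h s. h (s + 1) - h s) ^^ d) g s =
    (\<Sum>j\<le>d. (-1) ^ (d - j) * int (d choose j) * g (s + int j))"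
proof (induction d arbitrary: g s)
  case (Suc d)
  let ?c = "\<lambda>d j. (-1) ^ (d - j) * int (d choose j)"
  have "((\<lambda>h s. h (s + 1) - h s) ^^ Suc d) g s =
        (\<Sum>j\<le>d. ?c d j * g (s + 1 + int j)) - (\<Sum>j\<le>d. ?c d j * g (s + int j))"
    by (simp add: Suc.IH)
  also have "(\<Sum>j\<le>d. ?c d j * g (s + 1 + int j)) = (\<Sum>j\<le>d. ?c d j * g (s + int (Suc j)))"
    by (simp add: add_ac)
  also have "(\<Sum>j\<le>d. ?c d j * g (s + int j)) =
      (\<Sum>j\<le>Suc d. ?c d j * g (s + int j))"
    by simp
  also have "\<dots> = ?c d 0 * g s + (\<Sum>j\<le>d. ?c d (Suc j) * g (s + int (Suc j)))"
    by (subst sum.atMost_Suc_shift) simp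
  also have "(\<Sum>j\<le>d. ?c d j * g (s + int (Suc j))) -
      (?c d 0 * g s + (\<Sum>j\<le>d. ?c d (Suc j) * g (s + int (Suc j)))) =
      - ?c d 0 * g s + (\<Sum>j\<le>d. (?c d j - ?c d (Suc j)) * g (s + int (Suc j)))"
    by (simp add: sum_subtractf algebra_simps)
  also have "(\<Sum>j\<le>d. (?c d j - ?c d (Suc j)) * g (s + int (Suc j))) =
     (\<Sum>j\<le>d. ?c (Suc d) (Suc j) * g (s + int (Suc j)))"
  proof (intro sum.cong refl, goal_cases)
    case (1 j)
    \<comment> \<open>At \<open>j = d\<close> the truncated \<open>d - Suc j\<close> has the wrong
      parity, but there \<open>d choose Suc d\<close> is zero.\<close>
    show ?case
    proof (cases "j = d")
      case False
      then have "d - j = Suc (d - Suc j)" using 1 by auto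
      then show ?thesis by (simp add: algebra_simps)
    qed simp
  qed
  also have "- ?c d 0 * g s = ?c (Suc d) 0 * g (s + int 0)" by simp
  also have "?c (Suc d) 0 * g (s + int 0) + (\<Sum>j\<le>d. ?c (Suc d) (Suc j) * g (s + int (Suc j))) =
     (\<Sum>j\<le>Suc d. ?c (Suc d) j * g (s + int j))"
    by (rule sum.atMost_Suc_shift[symmetric])
  finally show ?case .
qed simp

text \<open>By absorption \<open>p ^ k\<close> divides \<open>j * (p ^ k choose j)\<close>; if
  \<open>p\<close> did not divide the binomial coefficient, \<open>p ^ k\<close> would divide
  \<open>j\<close>.\<close>

lemma prime_dvd_prime_power_choose:
  fixes p :: nat
  assumes "prime p" "0 < j" "j < p ^ k"
  shows "p dvd (p ^ k choose j)"
proof (rule ccontr)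
  assume "\<not> ?thesis"
  then have "coprime (p ^ k) (p ^ k choose j)"
    using assms(1) by (metis coprime_power_left_iff prime_imp_coprime)
  moreover have "p ^ k dvd j * (p ^ k choose j)"
    by (metis assms(2) dvd_triv_left gr0_conv_Suc less_nat_zero_code binomial_absorption times_binomial_minus1_eq)
  ultimately have "p ^ k dvd j" by (metis coprime_dvd_mult_left_iff)
  with assms show False by (auto dest: dvd_imp_le)
qed

text \<open>With the unit shift \<open>T\<close> and \<open>q = p ^ k\<close>, this is
  \<open>(T - 1)^q = T^q - 1\<close> modulo \<open>p\<close>, which kills functions of period
  \<open>q\<close>. The inner binomial coefficients vanish; the two outer terms cancel for odd
  \<open>q\<close> and add up to \<open>2 * g s\<close> for \<open>p = 2\<close>.\<close>

lemma vanishing_diffs_periodic: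
  assumes "prime p" and periodic: "\<And>s. g (s + int (p ^ k)) = g s"
  shows "vanishing_diffs p (p ^ k) (\<lambda>x. g (x i))"
proof (rule vanishing_diffs_coordinate)
  fix s
  let ?q = "p ^ k"
  let ?t = "\<lambda>j. (-1) ^ (?q - j) * int (?q choose j) * g (s + int j)"
  have q: "?q > 0" using assms(1) prime_gt_0_nat by simp
  have "{..?q} = insert 0 (insert ?q {0<..<?q})" using q by auto
  then have *: "(\<Sum>j\<le>?q. ?t j) = (?t 0 + ?t ?q) + (\<Sum>j\<in>{0<..<?q}. ?t j)"
    using q by (simp add: sum.insert add.assoc)
  have middle: "int p dvd (\<Sum>j\<in>{0<..<?q}. ?t j)"
    using prime_dvd_prime_power_choose[OF assms(1)]
    by (intro dvd_sum) (auto intro!: dvd_mult dvd_mult2 simp: int_dvd_int_iff)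
  have t0: "?t 0 = (-1) ^ ?q * g s" and tq: "?t ?q = g s" using periodic[of s] by simp_all
  have ends: "int p dvd ?t 0 + ?t ?q"
  proof (cases "even ?q")
    case True
    then have "p = 2"
      using assms(1) prime_ge_2_nat[of p] prime_odd_nat[of p] by (metis even_power le_neq_implies_less)
    moreover have "?t 0 + ?t ?q = 2 * g s" unfolding t0 tq using True by simp
    ultimately show ?thesis by simp
  next
    case False
    then have "?t 0 + ?t ?q = 0" unfolding t0 tq by simp
    then show ?thesis by (metis dvd_0_right)
  qed
  show "int p dvd ((\<lambda>h s. h (s + 1) - h s) ^^ ?q) g s"
    unfolding iterated_difference * by (rule dvd_add[OF ends middle])
qed

text \<open>Up to sign the sum is the iterated difference of \<open>f\<close> at \<open>y\<close> in
  the directions \<open>x j\<close>. Splitting the subsets by whether they contain \<open>j\<close>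
  takes off one difference.\<close>

lemma vanishing_diffs_alternating_sum:
  assumes "finite J" "vanishing_diffs p (card J) f"
  shows "int p dvd (\<Sum>T\<in>Pow J. (-1) ^ card T * f (\<lambda>i. y i + (\<Sum>j\<in>T. x j i)))"
  using assms
proof (induction J arbitrary: f y rule: finite_induct)
  case (insert j J)
  let ?g = "\<lambda>z. f (\<lambda>i. z i + x j i) - f z"
  have *: "vanishing_diffs p (card J) ?g" using insert by simp
  have "inj_on (insert j) (Pow J)" using insert(2) by (meson Pow_iff inj_onI insert_ident subset_iff)
  then have "(\<Sum>T\<in>Pow (insert j J). (-1) ^ card T * f (\<lambda>i. y i + (\<Sum>j\<in>T. x j i))) =
    (\<Sum>T\<in>Pow J. (-1) ^ card T * f (\<lambda>i. y i + (\<Sum>j\<in>T. x j i))) +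
    (\<Sum>T\<in>Pow J. (-1) ^ card (insert j T) * f (\<lambda>i. y i + (\<Sum>j\<in>insert j T. x j i)))"
    unfolding Pow_insert using insert
    by (subst sum.union_disjoint) (auto simp: sum.reindex)
  also have "(\<Sum>T\<in>Pow J. (-1) ^ card (insert j T) * f (\<lambda>i. y i + (\<Sum>j\<in>insert j T. x j i))) =
    (\<Sum>T\<in>Pow J. - ((-1) ^ card T * f (\<lambda>i. y i + (\<Sum>j\<in>T. x j i) + x j i)))"
  proof (intro sum.cong refl, goal_cases)
    case (1 T)
    then have "finite T" "j \<notin> T" using insert by (auto intro: finite_subset)
    then show ?case by (simp add: add_ac)
  qed
  also have "(\<Sum>T\<in>Pow J. (-1) ^ card T * f (\<lambda>i. y i + (\<Sum>j\<in>T. x j i))) + \<dots> =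
     - (\<Sum>T\<in>Pow J. (-1) ^ card T * ?g (\<lambda>i. y i + (\<Sum>j\<in>T. x j i)))"
    by (simp add: sum_negf sum_subtractf algebra_simps)
  finally show ?case using insert.IH[OF *, of y] by simp
qed auto

text \<open>Olson's theorem for \<open>p\<close>-groups. If no nonempty subsum vanished, the indicator function of
  \<open>0\<close> would have an alternating sum over all subsets equal to \<open>1\<close>; but that sum is an iterated
  difference, which is divisible by \<open>p\<close>.\<close>

lemma prime_power_zero_sum:
  fixes x :: "'j \<Rightarrow> 'i \<Rightarrow> int" and p :: nat
  assumes p: "prime p" and I: "finite I" and J: "finite J"
    and card: "card J > (\<Sum>i\<in>I. p ^ k i - 1)"
  shows "\<exists>T\<subseteq>J. T \<noteq> {} \<and> (\<forall>i\<in>I. int (p ^ k i) dvd (\<Sum>j\<in>T. x j i))"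
proof (rule ccontr)
  assume neg: "\<not> ?thesis"
  \<comment> \<open>Exactly one term more than the total degree is kept, since the order of the
    differences must equal the number of terms.\<close>
  obtain J' where J': "J' \<subseteq> J" "card J' = Suc (\<Sum>i\<in>I. p ^ k i - 1)"
    using card by (meson Suc_leI obtain_subset_with_card_n)
  have fin: "finite J'" using J' J finite_subset by auto
  define g where "g = (\<lambda>i s. of_bool (int (p ^ k i) dvd s) :: int)"
  \<comment> \<open>The indicator of divisibility by \<open>p ^ k i\<close> is periodic, hence of
    degree at most \<open>p ^ k i - 1\<close>; these degrees add up in the product.\<close>
  have "vanishing_diffs p (Suc (p ^ k i - 1)) (\<lambda>x. g i (x i))" for i
    using vanishing_diffs_periodic[OF p, of "g i" "k i" i] p prime_gt_0_nat[OF p]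
    by (simp add: g_def)
  then have "vanishing_diffs p (card J') (\<lambda>x. \<Prod>i\<in>I. g i (x i))"
    unfolding J'(2) by (intro vanishing_diffs_prod I)
  from vanishing_diffs_alternating_sum[OF fin this, of "\<lambda>_. 0" x]
  have "int p dvd (\<Sum>T\<in>Pow J'. (-1) ^ card T * (\<Prod>i\<in>I. g i (\<Sum>j\<in>T. x j i)))" by simp
  also have "(\<Sum>T\<in>Pow J'. (-1) ^ card T * (\<Prod>i\<in>I. g i (\<Sum>j\<in>T. x j i))) =
     (\<Sum>T\<in>Pow J'. if T = {} then 1 else 0)"
  proof (intro sum.cong refl, goal_cases)
    case (1 T)
    show ?case
    proof (cases "T = {}")
      case False
      then obtain i where "i \<in> I" "\<not> int (p ^ k i) dvd (\<Sum>j\<in>T. x j i)"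
        using neg 1 J'(1) by blast
      then have "(\<Prod>i\<in>I. g i (\<Sum>j\<in>T. x j i)) = 0"
        using I by (subst prod_zero_iff) (auto simp: g_def)
      then show ?thesis using False by simp
    qed (simp add: g_def)
  qed
  also have "\<dots> = 1" using fin by simp
  finally show False using p by (simp add: not_prime_1)
qed

section \<open>Growth of sets of subsums\<close>

text \<open>The space of vectors modulo \<open>p\<close> with coordinates in \<open>I\<close>, as
  extensional functions with reduced values, so that it is a finite set. \<open>translate\<close>
  reduces back into it, while its shift may be any integer vector.\<close>

definition residue_box :: "nat \<Rightarrow> 'i set \<Rightarrow> ('i \<Rightarrow> int) set" where
  "residue_box p I = PiE I (\<lambda>_. {0..<int p})"

definition translate :: "nat \<Rightarrow> 'i set \<Rightarrow> ('i \<Rightarrow> int) \<Rightarrow> ('i \<Rightarrow> int) \<Rightarrow> ('i \<Rightarrow> int)" where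
  "translate p I d y = (\<lambda>i\<in>I. (y i + d i) mod int p)"

definition add_char :: "nat \<Rightarrow> int \<Rightarrow> complex" where
  "add_char p k = cis (2 * pi * of_int k / real p)"

lemma finite_residue_box: "finite I \<Longrightarrow> finite (residue_box p I)"
  unfolding residue_box_def by (intro finite_PiE) auto

lemma card_residue_box: "finite I \<Longrightarrow> card (residue_box p I) = p ^ card I"
  unfolding residue_box_def by (subst card_PiE) auto

lemma translate_in_box: "p > 0 \<Longrightarrow> translate p I d y \<in> residue_box p I"
  unfolding residue_box_def translate_def by auto

lemma translate_add: "translate p I d (translate p I d' y) = translate p I (\<lambda>i. d' i + d i) y"
  unfolding translate_def by (auto simp: mod_simps add_ac intro!: restrict_ext)

lemma residue_box_eqI:
  assumes "y \<in> residue_box p I" "z \<in> residue_box p I" "\<And>i. i \<in> I \<Longrightarrow> int p dvd y i - z i"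
  shows "y = z"
proof
  fix i
  show "y i = z i"
  proof (cases "i \<in> I")
    case True
    then have "y i mod int p = z i mod int p" using assms(3) by (simp add: mod_eq_dvd_iff)
    moreover have "y i \<in> {0..<int p}" "z i \<in> {0..<int p}"
      using assms True by (auto simp: residue_box_def)
    ultimately show ?thesis by simp
  next
    case False
    then have "y i = undefined" "z i = undefined"
      using assms(1,2) PiE_arb unfolding residue_box_def by metis+
    then show ?thesis by simp
  qed
qed

lemma translate_eq_iff:
  assumes "p > 0" "z \<in> residue_box p I"
  shows "translate p I d y = z \<longleftrightarrow> (\<forall>i\<in>I. int p dvd y i + d i - z i)"
proof
  assume "translate p I d y = z"
  then show "\<forall>i\<in>I. int p dvd y i + d i - z i"
    by (auto simp: translate_def mod_eq_dvd_iff[symmetric] mod_simps)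
next
  assume *: "\<forall>i\<in>I. int p dvd y i + d i - z i"
  show "translate p I d y = z"
  proof (rule residue_box_eqI[OF translate_in_box[OF assms(1)] assms(2)])
    fix i assume "i \<in> I"
    then show "int p dvd translate p I d y i - z i"
      using * by (auto simp: translate_def mod_eq_dvd_iff[symmetric] mod_simps)
  qed
qed

lemma inj_on_translate: "p > 0 \<Longrightarrow> inj_on (translate p I d) (residue_box p I)"
proof (rule inj_onI)
  fix y z assume p: "p > 0" and yz: "y \<in> residue_box p I" "z \<in> residue_box p I"
    and eq: "translate p I d y = translate p I d z"
  have "int p dvd y i - z i" if "i \<in> I" for i
  proof -
    have "(y i + d i) mod int p = (z i + d i) mod int p"
      using fun_cong[OF eq, of i] that by (simp add: translate_def)
    then show ?thesis by (simp add: mod_eq_dvd_iff)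
  qed
  then show "y = z" using residue_box_eqI yz by blast
qed

lemma translate_0: "p > 0 \<Longrightarrow> y \<in> residue_box p I \<Longrightarrow> translate p I (\<lambda>_. 0) y = y"
  by (subst translate_eq_iff) auto

section \<open>Additive characters modulo \<open>p\<close>, orthogonality and Parseval
  identities\<close>

lemma add_char_add: "add_char p (a + b) = add_char p a * add_char p b"
  by (simp add: add_char_def cis_mult add_divide_distrib distrib_left)

lemma add_char_0 [simp]: "add_char p 0 = 1"
  by (simp add: add_char_def)

lemma cnj_add_char: "cnj (add_char p a) = add_char p (- a)"
  by (simp add: add_char_def cis_cnj)

lemma add_char_sum: "add_char p (\<Sum>i\<in>I. f i) = (\<Prod>i\<in>I. add_char p (f i))"
  by (induction I rule: infinite_finite_induct) (auto simp: add_char_add)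

lemma add_char_eq_1_iff:
  assumes "p > 0"
  shows "add_char p k = 1 \<longleftrightarrow> int p dvd k"
proof
  assume "add_char p k = 1"
  then have "cos (2 * pi * of_int k / real p) = 1"
    by (simp add: add_char_def complex_eq_iff)
  then obtain n :: int where "2 * pi * of_int k / real p = of_int n * 2 * pi"
    unfolding cos_one_2pi_int by auto
  then have "(of_int k :: real) = of_int (int p * n)" using assms by (simp add: field_simps)
  then have "k = int p * n" by linarith
  then show "int p dvd k" by simp
next
  assume "int p dvd k"
  then obtain n where k: "k = int p * n" by auto
  have "2 * pi * of_int k / real p = 2 * pi * of_int n" using assms by (simp add: k)
  then show "add_char p k = 1" unfolding add_char_def by (metis Ints_of_int cis_multiple_2pi)
qed

lemma add_char_mult_nat: "add_char p (int t * k) = add_char p k ^ t"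
  by (induction t) (auto simp: algebra_simps add_char_add)

lemma add_char_orthogonality_nat:
  assumes "p > 0"
  shows "(\<Sum>t<p. add_char p (int t * k)) = (if int p dvd k then of_nat p else 0)"
proof (cases "int p dvd k")
  case True
  then show ?thesis using add_char_eq_1_iff[OF assms, of k] by (simp add: add_char_mult_nat)
next
  case False
  have "add_char p k ^ p = 1"
    using add_char_eq_1_iff[OF assms, of "int p * k"] by (simp flip: add_char_mult_nat)
  moreover have "add_char p k \<noteq> 1" using add_char_eq_1_iff[OF assms] False by simp
  ultimately show ?thesis using False by (simp add: add_char_mult_nat geometric_sum)
qed

lemma add_char_orthogonality:
  assumes "p > 0" "finite I"
  shows "(\<Sum>u\<in>residue_box p I. add_char p (\<Sum>i\<in>I. u i * d i)) =
         (if \<forall>i\<in>I. int p dvd d i then of_nat (p ^ card I) else 0)"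
proof -
  have int: "(\<Sum>t\<in>{0..<int p}. add_char p (t * k)) = (if int p dvd k then of_nat p else 0)" for k
  proof -
    have "{0..<int p} = int ` {..<p}"
      by (simp add: image_int_atLeastLessThan lessThan_atLeast0)
    then show ?thesis
      using add_char_orthogonality_nat[OF assms(1), of k] by (simp add: sum.reindex)
  qed
  have "(\<Sum>u\<in>residue_box p I. add_char p (\<Sum>i\<in>I. u i * d i)) =
        (\<Prod>i\<in>I. \<Sum>t\<in>{0..<int p}. add_char p (t * d i))"
    unfolding residue_box_def add_char_sum using assms by (subst prod_sum_PiE) auto
  also have "\<dots> = (\<Prod>i\<in>I. if int p dvd d i then of_nat p else 0)"
    by (simp only: int)
  also have "\<dots> = (if \<forall>i\<in>I. int p dvd d i then of_nat (p ^ card I) else 0)"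
    using assms by (auto intro: prod_zero)
  finally show ?thesis .
qed

text \<open>The autocorrelation of \<open>Y\<close> at shift \<open>d\<close> is the inverse
  transform of the squared modulus of the transform of \<open>Y\<close>: expanding the square,
  orthogonality keeps the pairs with \<open>z = y + d\<close>.\<close>

lemma card_overlap_Fourier:
  assumes "p > 0" "finite I" "Y \<subseteq> residue_box p I"
  shows "of_nat (p ^ card I * card {y\<in>Y. translate p I d y \<in> Y}) =
    (\<Sum>u\<in>residue_box p I. of_real ((cmod (\<Sum>y\<in>Y. add_char p (\<Sum>i\<in>I. u i * y i)))\<^sup>2) *
       add_char p (\<Sum>i\<in>I. u i * d i))"
proof -
  have fin: "finite Y" using assms finite_residue_box finite_subset by metis
  let ?e = "\<lambda>u d. add_char p (\<Sum>i\<in>I. u i * d i)"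
  have norm: "of_real ((cmod (\<Sum>y\<in>Y. ?e u y))\<^sup>2) * ?e u d =
      (\<Sum>y\<in>Y. \<Sum>z\<in>Y. ?e u (\<lambda>i. y i + d i - z i))" for u
  proof -
    have "of_real ((cmod (\<Sum>y\<in>Y. ?e u y))\<^sup>2) * ?e u d =
       (\<Sum>y\<in>Y. \<Sum>z\<in>Y. ?e u y * cnj (?e u z) * ?e u d)"
      unfolding complex_norm_square cnj_sum
      by (subst sum_product) (simp add: sum_distrib_right)
    also have "\<dots> = (\<Sum>y\<in>Y. \<Sum>z\<in>Y. ?e u (\<lambda>i. y i + d i - z i))"
    proof (intro sum.cong refl)
      fix y z
      have "(\<Sum>i\<in>I. u i * (y i + d i - z i)) =
         (\<Sum>i\<in>I. u i * y i) + - (\<Sum>i\<in>I. u i * z i) + (\<Sum>i\<in>I. u i * d i)"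
        by (simp add: algebra_simps sum.distrib sum_subtractf)
      then show "?e u y * cnj (?e u z) * ?e u d = ?e u (\<lambda>i. y i + d i - z i)"
        by (simp only: cnj_add_char add_char_add)
    qed
    finally show ?thesis .
  qed
  have "(\<Sum>u\<in>residue_box p I. of_real ((cmod (\<Sum>y\<in>Y. ?e u y))\<^sup>2) * ?e u d) =
    (\<Sum>y\<in>Y. \<Sum>z\<in>Y. \<Sum>u\<in>residue_box p I. ?e u (\<lambda>i. y i + d i - z i))"
    unfolding norm by (subst sum.swap) (intro sum.cong refl sum.swap)
  also have "\<dots> = (\<Sum>y\<in>Y. \<Sum>z\<in>Y. if translate p I d y = z then of_nat (p ^ card I) else 0)"
    unfolding add_char_orthogonality[OF assms(1,2)]
    using assms translate_eq_iff[OF assms(1), where I = I and d = d]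
    by (intro sum.cong refl) auto
  also have "\<dots> = (\<Sum>y\<in>Y. if translate p I d y \<in> Y then of_nat (p ^ card I) else 0)"
    using fin by simp
  also have "\<dots> = of_nat (p ^ card I * card {y\<in>Y. translate p I d y \<in> Y})"
    using fin by (simp add: sum.If_cases Int_def)
  finally show ?thesis ..
qed

lemma Parseval_residue_box:
  assumes "p > 0" "finite I" "Y \<subseteq> residue_box p I"
  shows "(\<Sum>u\<in>residue_box p I. (cmod (\<Sum>y\<in>Y. add_char p (\<Sum>i\<in>I. u i * y i)))\<^sup>2) =
    real (p ^ card I * card Y)"
proof -
  have "translate p I (\<lambda>_. 0) y = y" if "y \<in> Y" for y
    using that assms by (intro translate_0) auto
  then have *: "{y\<in>Y. translate p I (\<lambda>_. 0) y \<in> Y} = Y" by auto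
  have "complex_of_real (\<Sum>u\<in>residue_box p I. (cmod (\<Sum>y\<in>Y. add_char p (\<Sum>i\<in>I. u i * y i)))\<^sup>2) =
    of_real (real (p ^ card I * card Y))"
    using card_overlap_Fourier[OF assms, of "\<lambda>_. 0"] unfolding * by simp
  then show ?thesis by (simp only: of_real_eq_iff)
qed

text \<open>One-dimensional Parseval for the distribution of \<open>f\<close> modulo
  \<open>p\<close>. The right-hand side counts collisions, which are few when no hyperplane holds
  many terms.\<close>

lemma Parseval_multiples:
  assumes "p > 0" "finite A"
  shows "(\<Sum>k<p. (cmod (\<Sum>a\<in>A. add_char p (int k * f a)))\<^sup>2) =
    real p * (\<Sum>a\<in>A. real (card {b\<in>A. int p dvd f b - f a}))"
proof -
  have "complex_of_real (\<Sum>k<p. (cmod (\<Sum>a\<in>A. add_char p (int k * f a)))\<^sup>2) =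
     (\<Sum>k<p. \<Sum>b\<in>A. \<Sum>a\<in>A. add_char p (int k * (f b - f a)))"
    unfolding of_real_sum complex_norm_square cnj_sum
    by (subst sum_product) (simp add: cnj_add_char add_char_add[symmetric] algebra_simps)
  also have "\<dots> = (\<Sum>b\<in>A. \<Sum>a\<in>A. \<Sum>k<p. add_char p (int k * (f b - f a)))"
    by (subst sum.swap) (intro sum.cong refl sum.swap)
  also have "\<dots> = (\<Sum>b\<in>A. \<Sum>a\<in>A. if int p dvd f b - f a then of_nat p else 0)"
    by (simp only: add_char_orthogonality_nat[OF assms(1)])
  also have "\<dots> = (\<Sum>a\<in>A. \<Sum>b\<in>A. if int p dvd f b - f a then of_nat p else 0)"
    by (rule sum.swap)
  also have "\<dots> = of_real (real p * (\<Sum>a\<in>A. real (card {b\<in>A. int p dvd f b - f a})))"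
    using assms by (simp add: sum.If_cases Int_def sum_distrib_left mult.commute)
  finally show ?thesis by (simp only: of_real_eq_iff)
qed

text \<open>Average the overlap over all \<open>k < K\<close> and all pairs \<open>a, b\<close>. In
  Fourier form the trivial frequency has weight at most \<open>M\<close> and, because few terms
  share a hyperplane, every other one at most \<open>M / 2\<close>. As \<open>Y\<close> fills at
  most half of the box, the mean overlap is at most \<open>3 / 4 * card Y\<close>. The multiples
  \<open>k\<close> are there because non-concentration controls character sums only on average over
  multiples of a frequency.\<close>

lemma small_overlap_exists:
  fixes x :: "'j \<Rightarrow> 'i \<Rightarrow> int"
  assumes p: "p > 0" and I: "finite I" and A: "finite A" "A \<noteq> {}"
    and Y: "Y \<subseteq> residue_box p I" "2 * card Y \<le> p ^ card I"
    and K: "0 < K" "K \<le> p"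
    and conc: "\<And>u a. u \<in> residue_box p I \<Longrightarrow> \<exists>i\<in>I. u i \<noteq> 0 \<Longrightarrow> a \<in> A \<Longrightarrow>
      card {b\<in>A. int p dvd (\<Sum>i\<in>I. u i * x b i) - (\<Sum>i\<in>I. u i * x a i)} \<le> N"
    and N: "2 * p * N \<le> K * card A"
  shows "\<exists>k<K. \<exists>a\<in>A. \<exists>b\<in>A.
    4 * card {y\<in>Y. translate p I (\<lambda>i. int k * (x a i - x b i)) y \<in> Y} \<le> 3 * card Y"
proof (rule ccontr)
  assume neg: "\<not> ?thesis"
  let ?V = "residue_box p I"
  define dot where "dot = (\<lambda>u d. \<Sum>i\<in>I. u i * d i :: int)"
  define cnt where "cnt = (\<lambda>k a b. card {y\<in>Y. translate p I (\<lambda>i. int k * (x a i - x b i)) y \<in> Y})"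
  define F where "F = (\<lambda>u. (cmod (\<Sum>y\<in>Y. add_char p (dot u y)))\<^sup>2)"
  define G where "G = (\<lambda>u. \<Sum>k<K. (cmod (\<Sum>a\<in>A. add_char p (int k * dot u (x a))))\<^sup>2)"
  define M where "M = real K * real (card A) ^ 2"
  define P where "P = real (p ^ card I)"
  define S where "S = (\<Sum>k<K. \<Sum>a\<in>A. \<Sum>b\<in>A. real (cnt k a b))"
  define z where "z = (\<lambda>i\<in>I. 0 :: int)"
  have finV: "finite ?V" using I finite_residue_box by blast
  have finY: "finite Y" using Y(1) finV finite_subset by blast
  have zV: "z \<in> ?V" using p by (auto simp: z_def residue_box_def)
  have P0: "P > 0" using p by (simp add: P_def)
  have G_eq: "of_real (G u) =
     (\<Sum>k<K. \<Sum>a\<in>A. \<Sum>b\<in>A. add_char p (dot u (\<lambda>i. int k * (x a i - x b i))))" for u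
  proof -
    have "dot u (\<lambda>i. int k * (x a i - x b i)) = int k * dot u (x a) + - (int k * dot u (x b))"
      for k a b
      by (simp add: dot_def sum_distrib_left sum_subtractf algebra_simps)
    then show ?thesis
      unfolding G_def of_real_sum complex_norm_square cnj_sum
      by (subst sum_product) (simp only: cnj_add_char add_char_add)
  qed
  have "complex_of_real (P * S) =
     (\<Sum>k<K. \<Sum>a\<in>A. \<Sum>b\<in>A. of_nat (p ^ card I * cnt k a b))"
    by (simp add: P_def S_def sum_distrib_left)
  also have "\<dots> = (\<Sum>k<K. \<Sum>a\<in>A. \<Sum>b\<in>A. \<Sum>u\<in>?V.
      of_real (F u) * add_char p (dot u (\<lambda>i. int k * (x a i - x b i))))"
    unfolding cnt_def card_overlap_Fourier[OF p I Y(1)] F_def dot_def ..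
  also have "\<dots> = (\<Sum>k<K. \<Sum>a\<in>A. \<Sum>u\<in>?V. \<Sum>b\<in>A.
      of_real (F u) * add_char p (dot u (\<lambda>i. int k * (x a i - x b i))))"
    by (intro sum.cong refl sum.swap)
  also have "\<dots> = (\<Sum>k<K. \<Sum>u\<in>?V. \<Sum>a\<in>A. \<Sum>b\<in>A.
      of_real (F u) * add_char p (dot u (\<lambda>i. int k * (x a i - x b i))))"
    by (intro sum.cong refl sum.swap)
  also have "\<dots> = (\<Sum>u\<in>?V. \<Sum>k<K. \<Sum>a\<in>A. \<Sum>b\<in>A.
      of_real (F u) * add_char p (dot u (\<lambda>i. int k * (x a i - x b i))))"
    by (rule sum.swap)
  also have "\<dots> = (\<Sum>u\<in>?V. of_real (F u) * of_real (G u))"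
    by (simp only: G_eq sum_distrib_left)
  also have "\<dots> = of_real (\<Sum>u\<in>?V. F u * G u)" by simp
  finally have PS: "P * S = (\<Sum>u\<in>?V. F u * G u)" by (simp only: of_real_eq_iff)
  have Gz: "G z \<le> M"
  proof -
    have "G z = (\<Sum>k<K. (real (card A))\<^sup>2)" by (simp add: G_def dot_def z_def)
    then show ?thesis by (simp add: M_def)
  qed
  have Gu: "G u \<le> M / 2" if u: "u \<in> ?V" "u \<noteq> z" for u
  proof -
    have nz: "\<exists>i\<in>I. u i \<noteq> 0"
    proof (rule ccontr)
      assume "\<not> ?thesis"
      then have "u = z" using u zV by (intro residue_box_eqI[of u p I z]) (auto simp: z_def)
      with u show False by simp
    qed
    \<comment> \<open>Extending the range from \<open>K\<close> to \<open>p\<close> adds nonnegative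
      terms only and makes Parseval applicable.\<close>
    have "G u \<le> (\<Sum>k<p. (cmod (\<Sum>a\<in>A. add_char p (int k * dot u (x a))))\<^sup>2)"
      unfolding G_def using K by (intro sum_mono2) auto
    also have "\<dots> = real p * (\<Sum>a\<in>A. real (card {b\<in>A. int p dvd dot u (x b) - dot u (x a)}))"
      by (rule Parseval_multiples[OF p A(1)])
    also have "\<dots> \<le> real p * (\<Sum>a\<in>A. real N)"
      using conc[OF u(1) nz] unfolding dot_def by (intro mult_left_mono sum_mono) auto
    also have "\<dots> = real (2 * p * N) * real (card A) / 2" by simp
    also have "\<dots> \<le> real (K * card A) * real (card A) / 2"
      using N by (intro divide_right_mono mult_right_mono) (simp_all del: of_nat_mult)
    also have "\<dots> = M / 2" by (simp add: M_def power2_eq_square)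
    finally show ?thesis .
  qed
  have Fz: "F z = real (card Y) ^ 2" by (simp add: F_def dot_def z_def)
  have F0: "F u \<ge> 0" for u by (simp add: F_def)
  have Fsum: "(\<Sum>u\<in>?V. F u) = P * real (card Y)"
    unfolding F_def dot_def Parseval_residue_box[OF p I Y(1)] by (simp add: P_def)
  have M0: "M > 0" using K A by (simp add: M_def card_gt_0_iff)
  \<comment> \<open>The trivial frequency \<open>z\<close> is split off; Parseval for
    \<open>Y\<close> bounds the total weight of the others.\<close>
  have "P * S = F z * G z + (\<Sum>u\<in>?V - {z}. F u * G u)"
    unfolding PS by (rule sum.remove[OF finV zV])
  also have "\<dots> \<le> F z * M + (\<Sum>u\<in>?V - {z}. F u * (M / 2))"
    using F0 Gz Gu by (intro add_mono mult_left_mono sum_mono) auto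
  also have "(\<Sum>u\<in>?V - {z}. F u * (M / 2)) = (P * real (card Y) - F z) * (M / 2)"
    unfolding Fsum[symmetric] sum.remove[OF finV zV, of F] by (simp add: sum_distrib_right)
  also have "F z * M + (P * real (card Y) - F z) * (M / 2) =
      M / 2 * (P * real (card Y) + real (card Y) * real (card Y))"
    by (simp add: Fz power2_eq_square field_simps)
  also have "\<dots> \<le> M / 2 * (P * real (card Y) + P / 2 * real (card Y))"
  proof -
    have "real (2 * card Y) \<le> P" using Y(2) unfolding P_def of_nat_le_iff .
    then show ?thesis using M0 by (intro mult_left_mono add_left_mono mult_right_mono) auto
  qed
  also have "\<dots> = P * (3 / 4 * M * real (card Y))" by (simp add: field_simps)
  finally have S_le: "S \<le> 3 / 4 * M * real (card Y)" using P0 by simp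
  have "(\<Sum>k<K. \<Sum>a\<in>A. \<Sum>b\<in>A. 3 / 4 * real (card Y)) < S"
    unfolding S_def
  proof (intro sum_strict_mono)
    fix k a b assume "k \<in> {..<K}" "a \<in> A" "b \<in> A"
    then have "\<not> 4 * cnt k a b \<le> 3 * card Y" using neg by (auto simp: cnt_def)
    then show "3 / 4 * real (card Y) < real (cnt k a b)" by linarith
  qed (use K A in auto)
  also have "(\<Sum>k<K. \<Sum>a\<in>A. \<Sum>b\<in>A. 3 / 4 * real (card Y)) = 3 / 4 * M * real (card Y)"
    by (simp add: M_def power2_eq_square)
  finally show False using S_le by simp
qed

text \<open>Subadditivity: when \<open>Y\<close> moves by \<open>k * d\<close> in \<open>k\<close>
  steps, each step brings in at most as many new points as the first. This trades the multiple
  \<open>k\<close> for a factor \<open>k\<close>.\<close>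

lemma card_translate_multiple_diff:
  assumes p: "p > 0" and I: "finite I" and Y: "Y \<subseteq> residue_box p I"
  shows "card (translate p I (\<lambda>i. int k * d i) ` Y - Y) \<le> k * card (translate p I d ` Y - Y)"
proof (induction k)
  case 0
  have "translate p I (\<lambda>_. 0) ` Y = id ` Y"
    using Y by (intro image_cong) (auto simp: translate_0[OF p])
  then show ?case by simp
next
  case (Suc k)
  let ?D = "translate p I d ` Y - Y" and ?t = "translate p I (\<lambda>i. int k * d i)"
  have fin: "finite Y" using Y I finite_residue_box finite_subset by metis
  have "translate p I (\<lambda>i. int (Suc k) * d i) ` Y = ?t ` translate p I d ` Y"
    by (simp add: image_image translate_add algebra_simps)
  also have "\<dots> - Y \<subseteq> ?t ` ?D \<union> (?t ` Y - Y)" by auto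
  finally have "card (translate p I (\<lambda>i. int (Suc k) * d i) ` Y - Y) \<le> card (?t ` ?D \<union> (?t ` Y - Y))"
    using fin by (intro card_mono) auto
  also have "\<dots> \<le> card (?t ` ?D) + card (?t ` Y - Y)" by (rule card_Un_le)
  also have "\<dots> \<le> card ?D + k * card ?D" using Suc fin by (intro add_mono card_image_le) auto
  finally show ?case by simp
qed

text \<open>Some shift \<open>k * (x a - x b)\<close> moves at least a quarter of \<open>Y\<close>
  out of \<open>Y\<close>, so the single shift \<open>x a - x b\<close> moves at least
  \<open>card Y / (4 * K)\<close> points out.\<close>

lemma growth_step:
  fixes x :: "'j \<Rightarrow> 'i \<Rightarrow> int"
  assumes p: "p > 0" and I: "finite I" and A: "finite A" "A \<noteq> {}"
    and Y: "Y \<subseteq> residue_box p I" "2 * card Y \<le> p ^ card I"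
    and K: "0 < K" "K \<le> p"
    and conc: "\<And>u a. u \<in> residue_box p I \<Longrightarrow> \<exists>i\<in>I. u i \<noteq> 0 \<Longrightarrow> a \<in> A \<Longrightarrow>
      card {b\<in>A. int p dvd (\<Sum>i\<in>I. u i * x b i) - (\<Sum>i\<in>I. u i * x a i)} \<le> N"
    and N: "2 * p * N \<le> K * card A"
  shows "\<exists>a\<in>A. \<exists>b\<in>A. (1 + 1 / (4 * real K)) * real (card Y) \<le>
    real (card (translate p I (x a) ` Y \<union> translate p I (x b) ` Y))"
proof -
  obtain k a b where k: "k < K" and ab: "a \<in> A" "b \<in> A"
    and le: "4 * card {y\<in>Y. translate p I (\<lambda>i. int k * (x a i - x b i)) y \<in> Y} \<le> 3 * card Y"
    using small_overlap_exists[OF assms] by blast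
  let ?d = "\<lambda>i. x a i - x b i"
  let ?t = "translate p I (\<lambda>i. int k * ?d i)"
  have fin: "finite Y" using Y(1) I finite_residue_box finite_subset by metis
  have inj: "inj_on (translate p I d) Y" for d
    using inj_on_translate[OF p] Y(1) inj_on_subset by blast
  have "card Y = card (?t ` Y)" by (simp add: card_image inj)
  also have "?t ` Y = (?t ` Y - Y) \<union> ?t ` {y\<in>Y. ?t y \<in> Y}" by auto
  also have "card \<dots> \<le> card (?t ` Y - Y) + card (?t ` {y\<in>Y. ?t y \<in> Y})" by (rule card_Un_le)
  also have "\<dots> \<le> k * card (translate p I ?d ` Y - Y) + card {y\<in>Y. ?t y \<in> Y}"
    using card_translate_multiple_diff[OF p I Y(1)] fin by (intro add_mono card_image_le) auto
  also have "\<dots> \<le> K * card (translate p I ?d ` Y - Y) + card {y\<in>Y. ?t y \<in> Y}"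
    using k by simp
  finally have "card Y \<le> 4 * K * card (translate p I ?d ` Y - Y)" using le by linarith
  \<comment> \<open>Translating by \<open>x b\<close> turns the part of \<open>Y + a - b\<close>
    outside \<open>Y\<close> into the part of \<open>Y + a\<close> outside
    \<open>Y + b\<close>.\<close>
  moreover have "card (translate p I ?d ` Y - Y) \<le>
      card (translate p I (x a) ` Y - translate p I (x b) ` Y)"
  proof -
    have "translate p I (x b) ` (translate p I ?d ` Y - Y) =
        translate p I (x b) ` translate p I ?d ` Y - translate p I (x b) ` Y"
      using inj_on_translate[OF p] Y(1) translate_in_box[OF p]
      by (intro inj_on_image_set_diff[of _ "residue_box p I"]) auto
    also have "translate p I (x b) ` translate p I ?d ` Y = translate p I (x a) ` Y"
      by (simp add: image_image translate_add)
    finally have *: "translate p I (x b) ` (translate p I ?d ` Y - Y) =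
        translate p I (x a) ` Y - translate p I (x b) ` Y" .
    have "inj_on (translate p I (x b)) (translate p I ?d ` Y - Y)"
      using translate_in_box[OF p] by (intro inj_on_subset[OF inj_on_translate[OF p]]) auto
    from card_image[OF this] show ?thesis unfolding * by simp
  qed
  ultimately have "card Y \<le> 4 * K * card (translate p I (x a) ` Y - translate p I (x b) ` Y)"
    using le_trans mult_le_mono2 by blast
  then have "real (card Y) \<le> real (4 * K * card (translate p I (x a) ` Y - translate p I (x b) ` Y))"
    by (simp only: of_nat_le_iff)
  moreover have "card (translate p I (x a) ` Y \<union> translate p I (x b) ` Y) =
      card Y + card (translate p I (x a) ` Y - translate p I (x b) ` Y)"
  proof -
    have "translate p I (x a) ` Y \<union> translate p I (x b) ` Y =
       translate p I (x b) ` Y \<union> (translate p I (x a) ` Y - translate p I (x b) ` Y)" by auto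
    also have "card \<dots> = card (translate p I (x b) ` Y) +
       card (translate p I (x a) ` Y - translate p I (x b) ` Y)"
      using fin by (intro card_Un_disjoint) auto
    finally show ?thesis by (simp add: card_image inj)
  qed
  ultimately have "(1 + 1 / (4 * real K)) * real (card Y) \<le>
    real (card (translate p I (x a) ` Y \<union> translate p I (x b) ` Y))"
    using K by (simp add: field_simps)
  then show ?thesis using ab by blast
qed

text \<open>Each step reserves a fresh pair \<open>a, b\<close>, of which every subsum uses exactly
  one. So all subsums have length exactly \<open>s\<close> while at most \<open>2 * s\<close> terms
  are spent.\<close>

lemma growth_iterate:
  fixes x :: "'j \<Rightarrow> 'i \<Rightarrow> int"
  assumes p: "p > 0" and I: "finite I" and J: "finite J"
    and K: "0 < K" "K \<le> p"
    and conc: "\<And>u a. u \<in> residue_box p I \<Longrightarrow> \<exists>i\<in>I. u i \<noteq> 0 \<Longrightarrow> a \<in> J \<Longrightarrow>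
      card {b\<in>J. int p dvd (\<Sum>i\<in>I. u i * x b i) - (\<Sum>i\<in>I. u i * x a i)} \<le> N"
    and "2 * s \<le> card J" "2 * p * N \<le> K * (card J - 2 * s)"
  shows "\<exists>U Y. U \<subseteq> J \<and> card U \<le> 2 * s \<and> Y \<subseteq> residue_box p I \<and>
    (\<forall>y\<in>Y. \<exists>T\<subseteq>U. card T = s \<and> (\<forall>i\<in>I. int p dvd (\<Sum>j\<in>T. x j i) - y i)) \<and>
    (2 * card Y > p ^ card I \<or> real (card Y) \<ge> (1 + 1 / (4 * real K)) ^ s)"
  using assms(7,8)
proof (induction s)
  case 0
  let ?z = "\<lambda>i\<in>I. 0 :: int"
  show ?case
    using p by (intro exI[of _ "{}"] exI[of _ "{?z}"]) (auto simp: residue_box_def)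
next
  case (Suc s)
  have "K * (card J - 2 * Suc s) \<le> K * (card J - 2 * s)" by (intro mult_le_mono2) auto
  with Suc.prems have "2 * p * N \<le> K * (card J - 2 * s)" by linarith
  with Suc obtain U Y where U: "U \<subseteq> J" "card U \<le> 2 * s" and Y: "Y \<subseteq> residue_box p I"
    and sums: "\<And>y. y \<in> Y \<Longrightarrow> \<exists>T\<subseteq>U. card T = s \<and> (\<forall>i\<in>I. int p dvd (\<Sum>j\<in>T. x j i) - y i)"
    and large: "2 * card Y > p ^ card I \<or> real (card Y) \<ge> (1 + 1 / (4 * real K)) ^ s"
    by auto
  have finU: "finite U" and finY: "finite Y"
    using U(1) J Y I finite_residue_box finite_subset by metis+
  define A where "A = J - U"
  have cardA: "card J - 2 * s \<le> card A" using U finU by (simp add: A_def card_Diff_subset)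
  have "2 * s < card J" using Suc.prems(1) by simp
  then have "card A > 0" using cardA by linarith
  then have A: "finite A" "A \<noteq> {}" by (auto simp: card_gt_0_iff)
  have extend: "\<exists>T\<subseteq>insert a U. card T = Suc s \<and> (\<forall>i\<in>I. int p dvd (\<Sum>j\<in>T. x j i) - y i)"
    if a: "a \<in> A" and y: "y \<in> translate p I (x a) ` Y" for a y
  proof -
    obtain y' where y': "y' \<in> Y" "y = translate p I (x a) y'" using y by auto
    obtain T where T: "T \<subseteq> U" "card T = s" "\<forall>i\<in>I. int p dvd (\<Sum>j\<in>T. x j i) - y' i"
      using sums[OF y'(1)] by auto
    have T': "finite T" "a \<notin> T" using T finU a finite_subset by (auto simp: A_def)
    have "int p dvd (\<Sum>j\<in>insert a T. x j i) - y i" if "i \<in> I" for i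
    proof -
      have "int p dvd y' i + x a i - y i"
        using translate_eq_iff[OF p, of y I "x a" y'] translate_in_box[OF p, of I "x a" y'] y'(2) that
        by metis
      moreover have "int p dvd (\<Sum>j\<in>T. x j i) - y' i" using T(3) that by auto
      ultimately have "int p dvd (y' i + x a i - y i) + ((\<Sum>j\<in>T. x j i) - y' i)" by (rule dvd_add)
      then show ?thesis using T' by (simp add: algebra_simps)
    qed
    moreover have "card (insert a T) = Suc s" using T T' by simp
    ultimately show ?thesis using T(1) by (intro exI[of _ "insert a T"]) auto
  qed
  show ?case
  proof (cases "2 * card Y > p ^ card I")
    case True
    \<comment> \<open>More than half of the box is filled already; one translation merely raises the
      common length of the subsums and preserves the cardinality.\<close>
    obtain a where a: "a \<in> A" using A by auto
    have "card (translate p I (x a) ` Y) = card Y"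
      using inj_on_subset[OF inj_on_translate[OF p] Y] by (rule card_image)
    moreover have "card (insert a U) \<le> 2 * Suc s"
      using U(2) card_insert_le_m1[of "2 * Suc s" U a] by simp
    ultimately show ?thesis
      using a U(1) True extend[OF a] translate_in_box[OF p]
      by (intro exI[of _ "insert a U"] exI[of _ "translate p I (x a) ` Y"]) (auto simp: A_def)
  next
    case False
    have "\<exists>a\<in>A. \<exists>b\<in>A. (1 + 1 / (4 * real K)) * real (card Y) \<le>
      real (card (translate p I (x a) ` Y \<union> translate p I (x b) ` Y))"
    proof (rule growth_step[OF p I A Y _ K])
      show "2 * card Y \<le> p ^ card I" using False by simp
      show "2 * p * N \<le> K * card A"
        using \<open>2 * p * N \<le> K * (card J - 2 * s)\<close> cardA mult_le_mono2 le_trans by blast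
    next
      fix u a assume u: "u \<in> residue_box p I" "\<exists>i\<in>I. u i \<noteq> 0" and a: "a \<in> A"
      have "card {b\<in>A. int p dvd (\<Sum>i\<in>I. u i * x b i) - (\<Sum>i\<in>I. u i * x a i)} \<le>
            card {b\<in>J. int p dvd (\<Sum>i\<in>I. u i * x b i) - (\<Sum>i\<in>I. u i * x a i)}"
        using J by (intro card_mono) (auto simp: A_def)
      also have "\<dots> \<le> N" using conc[OF u] a by (auto simp: A_def)
      finally show "card {b\<in>A. int p dvd (\<Sum>i\<in>I. u i * x b i) - (\<Sum>i\<in>I. u i * x a i)} \<le> N" .
    qed
    then obtain a b where ab: "a \<in> A" "b \<in> A" and grow:
      "(1 + 1 / (4 * real K)) * real (card Y) \<le>
       real (card (translate p I (x a) ` Y \<union> translate p I (x b) ` Y))"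
      by blast
    let ?Y = "translate p I (x a) ` Y \<union> translate p I (x b) ` Y" and ?U = "insert a (insert b U)"
    have "(1 + 1 / (4 * real K)) ^ Suc s \<le> (1 + 1 / (4 * real K)) * real (card Y)"
      using large False by (simp add: mult_left_mono)
    with grow have "(1 + 1 / (4 * real K)) ^ Suc s \<le> real (card ?Y)" by linarith
    moreover have "card ?U \<le> 2 * Suc s"
    proof -
      have "card ?U \<le> Suc (Suc (card U))" using finU by (simp add: card_insert_if)
      then show ?thesis using U(2) by simp
    qed
    moreover have "\<exists>T\<subseteq>?U. card T = Suc s \<and> (\<forall>i\<in>I. int p dvd (\<Sum>j\<in>T. x j i) - y i)"
      if y: "y \<in> ?Y" for y
    proof -
      from y consider "y \<in> translate p I (x a) ` Y" | "y \<in> translate p I (x b) ` Y" by blast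
      then show ?thesis
      proof cases
        case 1
        from extend[OF ab(1) this] show ?thesis by (meson insert_mono order_trans subset_insertI)
      next
        case 2
        from extend[OF ab(2) this] show ?thesis by (meson order_trans subset_insertI)
      qed
    qed
    ultimately show ?thesis
      using ab U(1) translate_in_box[OF p]
      by (intro exI[of _ ?U] exI[of _ ?Y]) (auto simp: A_def)
  qed
qed

text \<open>Two disjoint groups of terms each have subsums filling more than half of the box, so by
  pigeonhole their sumset is everything.\<close>

lemma zero_sum_of_spread:
  fixes x :: "'j \<Rightarrow> 'i \<Rightarrow> int"
  assumes p: "p > 0" and I: "finite I" and J: "finite J"
    and K: "0 < K" "K \<le> p" and large: "real (p ^ card I) < 2 * (1 + 1 / (4 * real K)) ^ (p div 2)"
    and conc: "\<And>u a. u \<in> residue_box p I \<Longrightarrow> \<exists>i\<in>I. u i \<noteq> 0 \<Longrightarrow> a \<in> J \<Longrightarrow>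
      card {b\<in>J. int p dvd (\<Sum>i\<in>I. u i * x b i) - (\<Sum>i\<in>I. u i * x a i)} \<le> N"
    and N: "3 * p \<le> card J" "2 * p * N \<le> K * (card J - 2 * p)"
  shows "\<exists>T\<subseteq>J. card T = p \<and> (\<forall>i\<in>I. int p dvd (\<Sum>j\<in>T. x j i))"
proof -
  define s where "s = p div 2"
  have s: "2 * s \<le> p" by (simp add: s_def)
  let ?sums = "\<lambda>U Y. \<forall>y\<in>Y. \<exists>T\<subseteq>U. card T = s \<and> (\<forall>i\<in>I. int p dvd (\<Sum>j\<in>T. x j i) - y i)"
  have *: "\<exists>U Y. U \<subseteq> J' \<and> card U \<le> 2 * s \<and> Y \<subseteq> residue_box p I \<and> ?sums U Y \<and> 2 * card Y > p ^ card I"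
    if J': "J' \<subseteq> J" "card J \<le> card J' + p" for J'
  proof -
    \<comment> \<open>At most \<open>p\<close> terms are missing from \<open>J'\<close> and at most
      \<open>p\<close> more are spent by the growth inside it; this is the slack
      \<open>2 * p\<close> in the hypothesis.\<close>
    have "card J - 2 * p \<le> card J' - 2 * s" using J' s N(1) by linarith
    then have N': "2 * p * N \<le> K * (card J' - 2 * s)" using N(2) mult_le_mono2 le_trans by blast
    have s': "2 * s \<le> card J'" using J' s N(1) by linarith
    have "card {b\<in>J'. int p dvd (\<Sum>i\<in>I. u i * x b i) - (\<Sum>i\<in>I. u i * x a i)} \<le> N"
      if u: "u \<in> residue_box p I" "\<exists>i\<in>I. u i \<noteq> 0" and a: "a \<in> J'" for u a
    proof -
      have "card {b\<in>J'. int p dvd (\<Sum>i\<in>I. u i * x b i) - (\<Sum>i\<in>I. u i * x a i)} \<le>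
            card {b\<in>J. int p dvd (\<Sum>i\<in>I. u i * x b i) - (\<Sum>i\<in>I. u i * x a i)}"
        using J J' by (intro card_mono) auto
      also have "\<dots> \<le> N" using conc[OF u] a J' by auto
      finally show ?thesis .
    qed
    from growth_iterate[OF p I finite_subset[OF J'(1) J] K this s' N']
    obtain U Y where "U \<subseteq> J'" "card U \<le> 2 * s" "Y \<subseteq> residue_box p I" "?sums U Y"
      and or: "2 * card Y > p ^ card I \<or> real (card Y) \<ge> (1 + 1 / (4 * real K)) ^ s" by blast
    moreover from or have "2 * card Y > p ^ card I"
    proof
      assume "real (card Y) \<ge> (1 + 1 / (4 * real K)) ^ s"
      then have "real (p ^ card I) < real (2 * card Y)" using large by (simp add: s_def)
      then show ?thesis by (simp only: of_nat_less_iff)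
    qed
    ultimately show ?thesis by blast
  qed
  obtain U1 Y1 where 1: "U1 \<subseteq> J" "card U1 \<le> 2 * s" "Y1 \<subseteq> residue_box p I" "?sums U1 Y1"
      "2 * card Y1 > p ^ card I" using *[of J] by auto
  have fin1: "finite U1" "finite Y1" using 1 J I finite_residue_box finite_subset by metis+
  have "card J \<le> card (J - U1) + p" using 1 fin1 s by (simp add: card_Diff_subset)
  with *[of "J - U1"] obtain U2 Y2 where
    2: "U2 \<subseteq> J - U1" "card U2 \<le> 2 * s" "Y2 \<subseteq> residue_box p I" "?sums U2 Y2"
      "2 * card Y2 > p ^ card I" by auto
  have fin2: "finite U2" "finite Y2" using 2 J I finite_residue_box finite_subset by (metis finite_Diff)+
  have "p - 2 * s \<le> card (J - U1 - U2)"
    using 1 2 fin1 fin2 s N(1) by (simp add: card_Diff_subset)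
  \<comment> \<open>The filler \<open>F\<close> has \<open>p mod 2\<close> terms and brings the
    total length to exactly \<open>p\<close>.\<close>
  then obtain F where F: "F \<subseteq> J - U1 - U2" "card F = p - 2 * s"
    by (meson obtain_subset_with_card_n)
  have finF: "finite F" using F J finite_subset by blast
  \<comment> \<open>\<open>h y\<close> is what the second group has to contribute so that
    \<open>y\<close> and \<open>F\<close> are completed to zero.\<close>
  define h where "h = (\<lambda>y. \<lambda>i\<in>I. (- (\<Sum>j\<in>F. x j i) - y i) mod int p)"
  have "inj_on h Y1"
  proof (rule inj_onI)
    fix y z assume yz: "y \<in> Y1" "z \<in> Y1" "h y = h z"
    have "int p dvd y i - z i" if "i \<in> I" for i
    proof -
      have "(- (\<Sum>j\<in>F. x j i) - z i) mod int p = (- (\<Sum>j\<in>F. x j i) - y i) mod int p"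
        using fun_cong[OF yz(3), of i] that by (simp add: h_def)
      then show ?thesis by (simp add: mod_eq_dvd_iff)
    qed
    then show "y = z" using residue_box_eqI yz 1(3) by blast
  qed
  then have cardh: "card (h ` Y1) = card Y1" by (rule card_image)
  have hV: "h ` Y1 \<subseteq> residue_box p I" using p by (auto simp: h_def residue_box_def)
  have "h ` Y1 \<inter> Y2 \<noteq> {}"
  proof
    assume "h ` Y1 \<inter> Y2 = {}"
    then have "card (h ` Y1 \<union> Y2) = card Y1 + card Y2"
      using fin1 fin2 by (simp add: card_Un_disjoint cardh)
    moreover have "card (h ` Y1 \<union> Y2) \<le> p ^ card I"
      using hV 2(3) I finite_residue_box by (metis Un_least card_mono card_residue_box)
    ultimately show False using 1 2 by linarith
  qed
  then obtain y where y: "y \<in> Y1" "h y \<in> Y2" by auto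
  obtain T1 where T1: "T1 \<subseteq> U1" "card T1 = s" "\<forall>i\<in>I. int p dvd (\<Sum>j\<in>T1. x j i) - y i"
    using 1(4) y by blast
  obtain T2 where T2: "T2 \<subseteq> U2" "card T2 = s" "\<forall>i\<in>I. int p dvd (\<Sum>j\<in>T2. x j i) - h y i"
    using 2(4) y by blast
  have finT: "finite T1" "finite T2" using T1 T2 fin1 fin2 finite_subset by auto
  have disj: "T1 \<inter> T2 = {}" "(T1 \<union> T2) \<inter> F = {}" using T1 T2 F 2 by auto
  have "int p dvd (\<Sum>j\<in>T1 \<union> T2 \<union> F. x j i)" if i: "i \<in> I" for i
  proof -
    have "int p dvd h y i - (- (\<Sum>j\<in>F. x j i) - y i)"
      using i by (simp add: h_def mod_eq_dvd_iff[symmetric])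
    then have "int p dvd ((\<Sum>j\<in>T1. x j i) - y i) + ((\<Sum>j\<in>T2. x j i) - h y i) +
       (h y i - (- (\<Sum>j\<in>F. x j i) - y i))"
      using T1(3) T2(3) i by (intro dvd_add) auto
    then show ?thesis using finT finF disj by (simp add: sum.union_disjoint algebra_simps)
  qed
  moreover have "card (T1 \<union> T2 \<union> F) = p"
    using finT finF disj T1 T2 F s by (simp add: card_Un_disjoint)
  ultimately show ?thesis
    using T1 T2 F 1 2 by (intro exI[of _ "T1 \<union> T2 \<union> F"]) auto
qed

section \<open>Zero sums of prescribed length\<close>

text \<open>\<open>N\<close> is an upper bound for the Erdos-Ginzburg-Ziv constant of
  \<open>C_m^I\<close>: length and modulus agree. Indexed families allow repetitions, and numbered
  blocks can serve again as the terms of a new family.\<close>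

definition forces_zero_sum :: "'i set \<Rightarrow> nat \<Rightarrow> nat \<Rightarrow> bool" where
  "forces_zero_sum I m N \<longleftrightarrow> (\<forall>(J :: nat set) x. finite J \<and> N \<le> card J \<longrightarrow>
     (\<exists>T\<subseteq>J. card T = m \<and> (\<forall>i\<in>I. int m dvd (\<Sum>j\<in>T. x j i))))"

lemma forces_zero_sumD:
  fixes J :: "nat set"
  assumes "forces_zero_sum I m N" "finite J" "N \<le> card J"
  obtains T where "T \<subseteq> J" "card T = m" "\<And>i. i \<in> I \<Longrightarrow> int m dvd (\<Sum>j\<in>T. x j i)"
proof -
  have "\<exists>T\<subseteq>J. card T = m \<and> (\<forall>i\<in>I. int m dvd (\<Sum>j\<in>T. x j i))"
    using assms unfolding forces_zero_sum_def by simp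
  then show thesis using that by blast
qed

text \<open>Choose \<open>T\<close> by the other coordinates. Since \<open>T\<close> has exactly
  \<open>p\<close> terms, the constant \<open>c\<close> adds up to \<open>p * c\<close>, and the
  linear relation then forces the coordinate \<open>i0\<close>, whose coefficient is invertible, to
  vanish too.\<close>

lemma zero_sum_of_hyperplane:
  fixes x :: "nat \<Rightarrow> 'i \<Rightarrow> int"
  assumes p: "prime p" and I: "finite I" and i0: "i0 \<in> I" and u: "\<not> int p dvd u i0"
    and forces: "forces_zero_sum (I - {i0}) p N"
    and B: "finite B" "N \<le> card B"
    and hyperplane: "\<And>b. b \<in> B \<Longrightarrow> int p dvd (\<Sum>i\<in>I. u i * x b i) - c"
  shows "\<exists>T\<subseteq>B. card T = p \<and> (\<forall>i\<in>I. int p dvd (\<Sum>j\<in>T. x j i))"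
proof -
  obtain T where T: "T \<subseteq> B" "card T = p" "\<And>i. i \<in> I - {i0} \<Longrightarrow> int p dvd (\<Sum>j\<in>T. x j i)"
    using forces_zero_sumD[OF forces B] by blast
  have "int p dvd (\<Sum>j\<in>T. (\<Sum>i\<in>I. u i * x j i) - c)"
    using hyperplane T(1) by (intro dvd_sum) auto
  then have "int p dvd (\<Sum>j\<in>T. (\<Sum>i\<in>I. u i * x j i) - c) + int p * c" by simp
  also have "(\<Sum>j\<in>T. (\<Sum>i\<in>I. u i * x j i) - c) + int p * c = (\<Sum>i\<in>I. \<Sum>j\<in>T. u i * x j i)"
    using T(2) by (subst sum.swap) (simp add: sum_subtractf)
  also have "\<dots> = (\<Sum>i\<in>I. u i * (\<Sum>j\<in>T. x j i))" by (simp add: sum_distrib_left)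
  also have "\<dots> = u i0 * (\<Sum>j\<in>T. x j i0) + (\<Sum>i\<in>I - {i0}. u i * (\<Sum>j\<in>T. x j i))"
    by (rule sum.remove[OF I i0])
  finally have "int p dvd u i0 * (\<Sum>j\<in>T. x j i0) + (\<Sum>i\<in>I - {i0}. u i * (\<Sum>j\<in>T. x j i))" .
  moreover have "int p dvd (\<Sum>i\<in>I - {i0}. u i * (\<Sum>j\<in>T. x j i))"
    by (intro dvd_sum dvd_mult T(3))
  ultimately have "int p dvd u i0 * (\<Sum>j\<in>T. x j i0)" by (simp add: dvd_add_left_iff)
  then have "int p dvd (\<Sum>j\<in>T. x j i0)" using p u by (simp add: prime_dvd_mult_iff)
  then show ?thesis using T by (intro exI[of _ T]) auto
qed

text \<open>Induction on the dimension, with \<open>w\<close> the ratio of the bounds in consecutive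
  dimensions: either a hyperplane holds more than \<open>N\<close> terms and a coordinate is
  dropped, or the terms are spread and growth applies.\<close>

lemma forces_zero_sum_prime:
  fixes I :: "'i set"
  assumes p: "prime p" and I: "finite I" and K: "0 < K" "K \<le> p"
    and w: "3 \<le> w" "2 * p \<le> K * (w - 2)"
    and large: "real (p ^ card I) < 2 * (1 + 1 / (4 * real K)) ^ (p div 2)"
  shows "forces_zero_sum I p (p * w ^ card I)"
  using I large
proof (induction I rule: finite_psubset_induct)
  case (psubset I)
  have p0: "p > 0" using p by (rule prime_gt_0_nat)
  show ?case unfolding forces_zero_sum_def
  proof (intro allI impI, elim conjE)
    fix J :: "nat set" and x :: "nat \<Rightarrow> 'i \<Rightarrow> int"
    assume J: "finite J" "p * w ^ card I \<le> card J"
    show "\<exists>T\<subseteq>J. card T = p \<and> (\<forall>i\<in>I. int p dvd (\<Sum>j\<in>T. x j i))"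
    proof (cases "I = {}")
      case True
      then show ?thesis using J(2) by (metis card.empty empty_iff mult_1_right obtain_subset_with_card_n power_0)
    next
      case False
      then obtain d where d: "card I = Suc d" using psubset.hyps by (metis card_eq_0_iff not0_implies_Suc)
      \<comment> \<open>The bound for one dimension less also serves as the concentration
        threshold.\<close>
      define N where "N = p * w ^ d"
      have "p * 1 \<le> N" unfolding N_def using w(1) by (intro mult_le_mono2) simp
      then have pN: "p \<le> N" by simp
      have JN: "w * N \<le> card J" using J(2) by (simp add: d N_def mult_ac)
      let ?B = "\<lambda>u a. {b\<in>J. int p dvd (\<Sum>i\<in>I. u i * x b i) - (\<Sum>i\<in>I. u i * x a i)}"
      show ?thesis
      proof (cases "\<exists>u a. u \<in> residue_box p I \<and> (\<exists>i\<in>I. u i \<noteq> 0) \<and> a \<in> J \<and> N < card (?B u a)")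
        case True
        then obtain u a i0 where u: "u \<in> residue_box p I" "i0 \<in> I" "u i0 \<noteq> 0"
          and N: "N < card (?B u a)" by blast
        have "u i0 \<in> {0..<int p}" using u by (auto simp: residue_box_def)
        then have ndvd: "\<not> int p dvd u i0" using u(3) zdvd_not_zless by auto
        have card: "card (I - {i0}) = d" using u(2) d psubset.hyps by simp
        have "real (p ^ d) \<le> real (p ^ card I)"
          using p0 by (simp only: of_nat_le_iff d) (intro power_increasing, auto)
        then have "forces_zero_sum (I - {i0}) p N"
          using psubset.IH[of "I - {i0}"] u(2) psubset.prems card unfolding N_def by auto
        have "\<exists>T\<subseteq>?B u a. card T = p \<and> (\<forall>i\<in>I. int p dvd (\<Sum>j\<in>T. x j i))"
          by (rule zero_sum_of_hyperplane[where u = u and c = "\<Sum>i\<in>I. u i * x a i",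
                OF p psubset.hyps u(2) ndvd \<open>forces_zero_sum (I - {i0}) p N\<close>])
            (use N J(1) in auto)
        then show ?thesis by blast
      next
        case False
        have "w * N - 2 * N \<le> card J - 2 * p" using JN pN by linarith
        then have *: "(w - 2) * N \<le> card J - 2 * p" by (simp add: diff_mult_distrib)
        have "2 * p * N \<le> K * (w - 2) * N" using w(2) by (rule mult_le_mono1)
        also have "\<dots> \<le> K * (card J - 2 * p)" using * by (simp add: mult.assoc)
        finally have 1: "2 * p * N \<le> K * (card J - 2 * p)" .
        have "3 * p \<le> w * N" using w(1) pN by (rule mult_le_mono)
        then have 2: "3 * p \<le> card J" using JN by simp
        show ?thesis
          by (rule zero_sum_of_spread[OF p0 psubset.hyps J(1) K psubset.prems _ 2 1])
            (use False not_less in blast)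
      qed
    qed
  qed
qed

text \<open>Some residue vector occurs \<open>p\<close> times, and \<open>p\<close> equal vectors
  sum to zero. This crude bound serves for the primes too small for
  \<open>forces_zero_sum_polylog\<close>.\<close>

lemma forces_zero_sum_pigeonhole:
  fixes I :: "'i set"
  assumes p: "p > 0" and I: "finite I"
  shows "forces_zero_sum I p (p * p ^ card I)"
  unfolding forces_zero_sum_def
proof (intro allI impI, elim conjE)
  fix J :: "nat set" and x :: "nat \<Rightarrow> 'i \<Rightarrow> int"
  assume J: "finite J" "p * p ^ card I \<le> card J"
  define f where "f = (\<lambda>j. translate p I (x j) (\<lambda>_. 0))"
  have "f \<in> J \<rightarrow> residue_box p I" using translate_in_box[OF p] by (auto simp: f_def)
  moreover have "residue_box p I \<noteq> {}" using translate_in_box[OF p] by blast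
  ultimately have "\<exists>y\<in>residue_box p I. card J \<le> card (f -` {y} \<inter> J) * card (residue_box p I)"
    using pigeonhole_card[of f J "residue_box p I"] J(1) finite_residue_box[OF I] by simp
  then obtain y where "card J \<le> card (f -` {y} \<inter> J) * card (residue_box p I)" by blast
  then have "p * p ^ card I \<le> card (f -` {y} \<inter> J) * p ^ card I"
    using J(2) by (metis card_residue_box[OF I] le_trans)
  then have "p \<le> card (f -` {y} \<inter> J)"
    by (meson mult_le_cancel2 p zero_less_power)
  then obtain T where T: "T \<subseteq> f -` {y} \<inter> J" "card T = p" by (meson obtain_subset_with_card_n)
  have "int p dvd (\<Sum>j\<in>T. x j i)" if "i \<in> I" for i
  proof -
    have "x j i mod int p = y i" if j: "j \<in> T" for j
    proof -
      have "f j = y" using T(1) j by auto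
      then show ?thesis using \<open>i \<in> I\<close> by (auto simp: f_def translate_def)
    qed
    then have "(\<Sum>j\<in>T. x j i mod int p) = int p * y i" using T(2) by simp
    then have "(\<Sum>j\<in>T. x j i mod int p) mod int p = 0" by simp
    then show ?thesis by (simp add: mod_sum_eq dvd_eq_mod_eq_0)
  qed
  then show "\<exists>T\<subseteq>J. card T = p \<and> (\<forall>i\<in>I. int p dvd (\<Sum>j\<in>T. x j i))"
    using T by (intro exI[of _ T]) auto
qed

text \<open>Greedy extraction: before each of the \<open>k\<close> blocks is taken, at least
  \<open>N\<close> terms lie outside the earlier ones.\<close>

lemma disjoint_zero_sum_blocks:
  fixes J :: "nat set"
  assumes forces: "forces_zero_sum I m N" and J: "finite J"
  shows "m * k + N \<le> card J \<Longrightarrow> \<exists>B :: nat \<Rightarrow> nat set. disjoint_family_on B {..<k} \<and>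
    (\<forall>t<k. B t \<subseteq> J \<and> card (B t) = m \<and> (\<forall>i\<in>I. int m dvd (\<Sum>j\<in>B t. x j i)))"
proof (induction k)
  case 0
  show ?case by (auto simp: disjoint_family_on_def)
next
  case (Suc k)
  then obtain B :: "nat \<Rightarrow> nat set" where disj: "disjoint_family_on B {..<k}"
    and B: "\<And>t. t < k \<Longrightarrow> B t \<subseteq> J \<and> card (B t) = m \<and> (\<forall>i\<in>I. int m dvd (\<Sum>j\<in>B t. x j i))"
    by auto
  let ?U = "\<Union>t<k. B t"
  have U: "?U \<subseteq> J" using B by blast
  have "card ?U \<le> (\<Sum>t<k. card (B t))" by (rule card_UN_le) simp
  also have "\<dots> = m * k" using B by simp
  finally have "N \<le> card (J - ?U)"
    using Suc.prems card_Diff_subset[OF finite_subset[OF U J] U] by simp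
  then obtain T where T: "T \<subseteq> J - ?U" "card T = m" "\<And>i. i \<in> I \<Longrightarrow> int m dvd (\<Sum>j\<in>T. x j i)"
    using forces_zero_sumD[OF forces finite_Diff[OF J]] by blast
  have "disjoint_family_on (B(k := T)) {..<Suc k}"
    using disj T(1) unfolding disjoint_family_on_def lessThan_Suc by (simp add: disjoint_iff) blast
  moreover have "\<forall>t<Suc k. (B(k := T)) t \<subseteq> J \<and> card ((B(k := T)) t) = m \<and>
      (\<forall>i\<in>I. int m dvd (\<Sum>j\<in>(B(k := T)) t. x j i))"
    using B T by (auto simp: less_Suc_eq)
  ultimately show ?case by blast
qed

text \<open>Two levels: extract \<open>Nb\<close> blocks of length \<open>a\<close>, divide their
  sums by \<open>a\<close>, and choose \<open>b\<close> blocks whose quotients sum to zero modulo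
  \<open>b\<close>.\<close>

lemma forces_zero_sum_mult:
  fixes I :: "'i set"
  assumes a: "forces_zero_sum I a Na" and b: "forces_zero_sum I b Nb" and "a > 0"
  shows "forces_zero_sum I (a * b) (a * Nb + Na)"
  unfolding forces_zero_sum_def
proof (intro allI impI, elim conjE)
  fix J :: "nat set" and x :: "nat \<Rightarrow> 'i \<Rightarrow> int"
  assume J: "finite J" "a * Nb + Na \<le> card J"
  obtain B :: "nat \<Rightarrow> nat set" where disj: "disjoint_family_on B {..<Nb}"
    and B: "\<And>t. t < Nb \<Longrightarrow> B t \<subseteq> J \<and> card (B t) = a \<and> (\<forall>i\<in>I. int a dvd (\<Sum>j\<in>B t. x j i))"
    using disjoint_zero_sum_blocks[OF a J, of x] by blast
  obtain S where S: "S \<subseteq> {..<Nb}" "card S = b"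
    and sum: "\<And>i. i \<in> I \<Longrightarrow> int b dvd (\<Sum>t\<in>S. (\<Sum>j\<in>B t. x j i) div int a)"
    by (rule forces_zero_sumD[OF b, of "{..<Nb}" "\<lambda>t i. (\<Sum>j\<in>B t. x j i) div int a"]) auto
  have finS: "finite S" using S(1) finite_subset by blast
  have BJ: "B t \<subseteq> J" if "t \<in> S" for t using B[of t] S(1) that by blast
  then have finB: "\<forall>t\<in>S. finite (B t)" using J(1) finite_subset by metis
  have disjS: "\<forall>s\<in>S. \<forall>t\<in>S. s \<noteq> t \<longrightarrow> B s \<inter> B t = {}"
    using disj S(1) unfolding disjoint_family_on_def by blast
  have "card (\<Union>t\<in>S. B t) = a * b"
    using card_UN_disjoint[OF finS finB disjS] B S by (simp add: subset_iff mult.commute)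
  moreover have "int (a * b) dvd (\<Sum>j\<in>(\<Union>t\<in>S. B t). x j i)" if i: "i \<in> I" for i
  proof -
    have "(\<Sum>j\<in>(\<Union>t\<in>S. B t). x j i) = (\<Sum>t\<in>S. \<Sum>j\<in>B t. x j i)"
      by (rule sum.UNION_disjoint[OF finS finB disjS])
    also have "\<dots> = (\<Sum>t\<in>S. int a * ((\<Sum>j\<in>B t. x j i) div int a))"
      using B S(1) i by (intro sum.cong refl) (auto simp: subset_iff)
    also have "\<dots> = int a * (\<Sum>t\<in>S. (\<Sum>j\<in>B t. x j i) div int a)"
      by (simp add: sum_distrib_left)
    finally show ?thesis using sum[OF i] by simp
  qed
  moreover have "(\<Union>t\<in>S. B t) \<subseteq> J" using BJ by blast
  ultimately show "\<exists>T\<subseteq>J. card T = a * b \<and> (\<forall>i\<in>I. int (a * b) dvd (\<Sum>j\<in>T. x j i))" by blast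
qed

section \<open>Explicit bounds for prime and composite lengths\<close>

lemma two_power_le_growth:
  assumes "K > 0" "4 * K * l \<le> s"
  shows "2 ^ l \<le> (1 + 1 / (4 * real K)) ^ s"
proof -
  \<comment> \<open>By Bernoulli, \<open>4 * K\<close> growth factors together at least
    double.\<close>
  have "1 + real (4 * K) * (1 / (4 * real K)) \<le> (1 + 1 / (4 * real K)) ^ (4 * K)"
    by (rule Bernoulli_inequality) (simp add: order_trans[of _ 0])
  then have "2 \<le> (1 + 1 / (4 * real K)) ^ (4 * K)" using assms by simp
  then have "2 ^ l \<le> ((1 + 1 / (4 * real K)) ^ (4 * K)) ^ l" by (rule power_mono) simp
  also have "\<dots> = (1 + 1 / (4 * real K)) ^ (4 * K * l)" by (simp add: power_mult)
  also have "\<dots> \<le> (1 + 1 / (4 * real K)) ^ s" using assms by (intro power_increasing) auto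
  finally show ?thesis .
qed

text \<open>Here \<open>l\<close> bounds the binary logarithm of \<open>p\<close>. \<open>K\<close>
  is taken about \<open>p / (8 * R * l)\<close>, so that \<open>p div 2\<close> growth steps reach
  \<open>2 ^ (R * l)\<close>, which is at least \<open>p ^ R\<close>; then \<open>w\<close> need
  only be of order \<open>R * l\<close>.\<close>

lemma forces_zero_sum_polylog:
  fixes I :: "'i set"
  assumes p: "prime p" and I: "finite I" and R: "card I \<le> R" "0 < R" and l: "p \<le> 2 ^ l" "0 < l"
    and large: "20 * R * l \<le> p"
  shows "forces_zero_sum I p (p * (2 + 32 * R * l) ^ R)"
proof -
  define M where "M = 4 * R * l"
  define K where "K = (p div 2) div M"
  define w where "w = 2 + 32 * R * l"
  have M: "M > 0" "5 * M \<le> p" using R(2) l(2) large by (auto simp: M_def)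
  have "M \<le> p div 2" using M by linarith
  then have "M div M \<le> K" unfolding K_def by (rule div_le_mono)
  then have K: "0 < K" using M by simp
  have Kp: "K \<le> p" unfolding K_def by (meson div_le_dividend le_trans)
  have "p div 2 < M * K + M" unfolding K_def using M(1)
    by (metis add.commute add_less_cancel_right mod_less_divisor mult_div_mod_eq mult.commute)
  moreover have "M \<le> M * K" using K by simp
  \<comment> \<open>With \<open>w - 2 = 8 * M\<close> this is the required
    \<open>2 * p \<le> K * (w - 2)\<close>.\<close>
  ultimately have "p \<le> 4 * (M * K)" by linarith
  then have w: "3 \<le> w" "2 * p \<le> K * (w - 2)"
    using R(2) l(2) by (auto simp: w_def M_def mult_ac)
  have "4 * K * (R * l) \<le> p div 2"
  proof -
    have "M * K \<le> p div 2" unfolding K_def by (rule times_div_less_eq_dividend)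
    then show ?thesis by (simp add: M_def mult_ac)
  qed
  from two_power_le_growth[OF K this]
  have growth: "2 ^ (R * l) \<le> (1 + 1 / (4 * real K)) ^ (p div 2)" .
  have p1: "p \<ge> 1" using p prime_ge_1_nat by blast
  have "p ^ card I \<le> p ^ R" using p1 R(1) by (rule power_increasing[rotated])
  also have "\<dots> \<le> (2 ^ l) ^ R" using l(1) by (rule power_mono) simp
  also have "\<dots> = 2 ^ (R * l)" by (metis power_mult mult.commute)
  finally have "real (p ^ card I) \<le> real (2 ^ (R * l))" by (simp only: of_nat_le_iff)
  also have "\<dots> = 2 ^ (R * l)" by simp
  also have "\<dots> < 2 * (1 + 1 / (4 * real K)) ^ (p div 2)"
  proof -
    have "(0::real) < 2 ^ (R * l)" by simp
    with growth show ?thesis by linarith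
  qed
  finally have "forces_zero_sum I p (p * w ^ card I)"
    using forces_zero_sum_prime[OF p I K Kp w] by blast
  moreover have "p * w ^ card I \<le> p * w ^ R"
    using w R(1) by (intro mult_le_mono2 power_increasing) auto
  ultimately show ?thesis
    unfolding forces_zero_sum_def w_def by (meson le_trans)
qed

text \<open>With \<open>a = 1 / (2R)\<close>, the \<open>R\<close>-th power of \<open>log p\<close> is \<open>O(p\<^sup>1\<^sup>/\<^sup>2)\<close> because \<open>log p = O(p\<^sup>a)\<close>.\<close>

lemma forces_zero_sum_prime_bound:
  fixes I :: "'i set"
  assumes I: "finite I"
  shows "\<exists>C\<ge>1. \<forall>p. prime p \<longrightarrow>
    (\<exists>N. real N \<le> C * real p * sqrt (real p) \<and> forces_zero_sum I p N)"
proof -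
  define R where "R = Suc (card I)"
  \<comment> \<open>From the bound \<open>lb\<close> for \<open>l\<close> below,
    \<open>20 * R * l\<close> is at most \<open>E * p powr a\<close>, and
    \<open>2 + 32 * R * l\<close> is at most \<open>D * p powr a\<close>.\<close>
  define E where "E = 20 * real R * (2 + 4 * real R)"
  define D where "D = 2 + 32 * real R * (2 + 4 * real R)"
  have E1: "E \<ge> 1" by (simp add: E_def R_def algebra_simps)
  have D1: "D \<ge> 1" by (simp add: D_def)
  have main: "\<exists>N. real N \<le> (D ^ R + E ^ (2 * R)) * real p * sqrt (real p) \<and> forces_zero_sum I p N"
    if p: "prime p" for p
  proof -
    define l where "l = nat \<lceil>log 2 (real p)\<rceil> + 1"
    define a where "a = 1 / (2 * real R)"
    have p1: "real p \<ge> 1" using prime_ge_1_nat[OF p] by simp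
    have a: "0 < a" "a \<le> 1 / 2" by (auto simp: a_def R_def field_simps)
    have pa1: "real p powr a \<ge> 1" using p1 a by (simp add: ge_one_powr_ge_zero)
    have paR: "(real p powr a) ^ R = sqrt (real p)"
    proof -
      have "a * real R = 1 / 2" by (simp add: a_def R_def)
      moreover have "(real p powr a) ^ R = real p powr (a * real R)"
        using p1 by (simp add: powr_realpow[symmetric] powr_powr)
      ultimately have "(real p powr a) ^ R = real p powr (1 / 2)" by (simp only:)
      then show ?thesis using p1 by (simp add: powr_half_sqrt)
    qed
    have log0: "log 2 (real p) \<ge> 0" using p1 by simp
    have "real p = 2 powr log 2 (real p)" using p1 by simp
    also have "\<dots> \<le> 2 powr real l" using log0 by (intro powr_mono) (auto simp: l_def, linarith)
    also have "\<dots> = real (2 ^ l)" by (simp add: powr_realpow)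
    finally have l: "p \<le> 2 ^ l" by (simp only: of_nat_le_iff)
    have "real l \<le> log 2 (real p) + 2" using log0 unfolding l_def by linarith
    also have "log 2 (real p) \<le> 4 * real R * real p powr a"
    proof -
      have "(1/2 :: real) \<le> ln 2" using ln_le_minus_one[of "1 / 2 :: real"] by (simp add: ln_div)
      have "ln (real p) \<le> (real p powr a) / a" by (rule ln_powr_bound[OF p1 a(1)])
      also have "\<dots> = 2 * real R * real p powr a" by (simp add: a_def)
      also have "\<dots> \<le> 4 * real R * real p powr a * ln 2"
        using mult_left_mono[OF \<open>1/2 \<le> ln 2\<close>, of "4 * real R * real p powr a"] by simp
      finally show ?thesis by (simp add: log_def divide_le_eq)
    qed
    also have "2 \<le> 2 * real p powr a" using pa1 by simp
    finally have lb: "real l \<le> (2 + 4 * real R) * real p powr a" by (simp add: algebra_simps)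
    show ?thesis
    proof (cases "20 * R * l \<le> p")
      case True
      have "real (2 + 32 * R * l) \<le> 2 * real p powr a + 32 * real R * ((2 + 4 * real R) * real p powr a)"
        using pa1 mult_left_mono[OF lb, of "32 * real R"] by simp
      also have "\<dots> = D * real p powr a" by (simp add: D_def algebra_simps)
      finally have "real (2 + 32 * R * l) ^ R \<le> (D * real p powr a) ^ R" by (rule power_mono) simp
      also have "\<dots> = D ^ R * sqrt (real p)" by (simp add: power_mult_distrib paR)
      also have "\<dots> \<le> (D ^ R + E ^ (2 * R)) * sqrt (real p)"
        using E1 by (intro mult_right_mono) auto
      finally have "real (p * (2 + 32 * R * l) ^ R) \<le> (D ^ R + E ^ (2 * R)) * real p * sqrt (real p)"
        by (simp add: mult_left_mono mult.assoc mult.left_commute[of _ "real p"])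
      moreover have "forces_zero_sum I p (p * (2 + 32 * R * l) ^ R)"
        by (rule forces_zero_sum_polylog[OF p I _ _ l _ True]) (auto simp: R_def l_def)
      ultimately show ?thesis by blast
    next
      case False
      \<comment> \<open>Here \<open>p\<close> is at most \<open>E * sqrt p\<close>, so
        \<open>p\<close> is bounded by \<open>E\<^sup>2\<close> and the pigeonhole bound costs only
        a constant factor.\<close>
      have "real p \<le> real (20 * R * l)" using False by (simp only: of_nat_le_iff)
      also have "\<dots> \<le> 20 * real R * ((2 + 4 * real R) * real p powr a)"
        using mult_left_mono[OF lb, of "20 * real R"] by simp
      also have "\<dots> = E * real p powr a" by (simp add: E_def)
      also have "\<dots> \<le> E * sqrt (real p)"
        using p1 a E1 by (intro mult_left_mono) (auto simp: powr_half_sqrt[symmetric] intro!: powr_mono)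
      finally have "sqrt (real p) * sqrt (real p) \<le> E * sqrt (real p)" by simp
      then have "sqrt (real p) \<le> E" using p1 by (subst (asm) mult_le_cancel_right) auto
      then have "(sqrt (real p))\<^sup>2 \<le> E\<^sup>2" by (rule power_mono) simp
      then have "real p \<le> E\<^sup>2" by simp
      then have "real p ^ card I \<le> (E\<^sup>2) ^ card I" by (rule power_mono) simp
      also have "\<dots> \<le> (E\<^sup>2) ^ R" using E1 by (intro power_increasing) (auto simp: R_def)
      also have "\<dots> = E ^ (2 * R)" by (simp add: power_mult)
      also have "\<dots> \<le> (D ^ R + E ^ (2 * R)) * sqrt (real p)"
      proof -
        have "E ^ (2 * R) * 1 \<le> (D ^ R + E ^ (2 * R)) * sqrt (real p)"
          using E1 D1 p1 by (intro mult_mono) auto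
        then show ?thesis by simp
      qed
      finally have "real (p * p ^ card I) \<le> (D ^ R + E ^ (2 * R)) * real p * sqrt (real p)"
        by (simp add: mult_left_mono mult.assoc mult.left_commute[of _ "real p"])
      then show ?thesis
        using forces_zero_sum_pigeonhole[OF prime_gt_0_nat[OF p] I] by blast
    qed
  qed
  have "1 \<le> D ^ R" using D1 by simp
  moreover have "0 \<le> E ^ (2 * R)" using E1 by simp
  ultimately have "D ^ R + E ^ (2 * R) \<ge> 1" by linarith
  with main show ?thesis by blast
qed

text \<open>Peeling off the smallest prime factor \<open>p\<close> of \<open>m\<close> makes the errors sum to a convergent series:
  the step costs at most \<open>C m / sqrt b\<close> with \<open>b = m / p \<ge> p\<close>.\<close>

lemma forces_zero_sum_bound:
  fixes I :: "'i set" and Q :: real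
  assumes C: "C \<ge> 1" and primes: "\<And>p. prime p \<Longrightarrow>
      \<exists>N. real N \<le> C * real p * sqrt (real p) \<and> forces_zero_sum I p N"
    and Q: "Q \<ge> 1"
  shows "m > 0 \<Longrightarrow> (\<And>p. prime p \<Longrightarrow> p dvd m \<Longrightarrow> real p \<le> Q) \<Longrightarrow>
    \<exists>N. real N \<le> real m * (C * sqrt Q + 4 * C - 4 * C / sqrt (real m)) \<and> forces_zero_sum I m N"
proof (induction m rule: less_induct)
  case (less m)
  show ?case
  proof (cases "m = 1")
    case True
    have "forces_zero_sum I 1 1"
      unfolding forces_zero_sum_def by (auto intro: obtain_subset_with_card_n)
    moreover have "1 * 1 \<le> C * sqrt Q" using C Q by (intro mult_mono) auto
    ultimately show ?thesis using True by (intro exI[of _ 1]) simp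
  next
    case False
    define p where "p = (LEAST p. prime p \<and> p dvd m)"
    have "\<exists>p. prime p \<and> p dvd m" using False prime_factor_nat by blast
    from LeastI_ex[OF this] have p: "prime p" "p dvd m" by (auto simp: p_def)
    have p_least: "p \<le> p'" if "prime p'" "p' dvd m" for p'
      unfolding p_def using that by (intro Least_le) auto
    have p2: "real p \<ge> 2" using prime_ge_2_nat[OF p(1)] by simp
    obtain b where b: "m = p * b" using p(2) by auto
    have b0: "b > 0" using less.prems(1) b by (cases b) auto
    obtain Np where Np: "real Np \<le> C * real p * sqrt (real p)" "forces_zero_sum I p Np"
      using primes[OF p(1)] by blast
    show ?thesis
    proof (cases "b = 1")
      case True
      \<comment> \<open>The bound \<open>Q\<close> is spent only here, on the last and largest prime
        factor.\<close>
      have "sqrt (real p) \<le> sqrt Q" using less.prems(2)[OF p] by simp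
      then have "real p * (C * sqrt (real p)) \<le> real p * (C * sqrt Q)"
        using C by (intro mult_left_mono) auto
      moreover have "0 \<le> real p * (4 * C - 4 * C / sqrt (real p))"
      proof -
        have "4 * C / sqrt (real p) \<le> 4 * C / 1" using p2 C by (intro divide_left_mono) auto
        then show ?thesis by simp
      qed
      ultimately have "real Np \<le> real m * (C * sqrt Q + 4 * C - 4 * C / sqrt (real m))"
        using Np(1) by (simp add: b True algebra_simps)
      then show ?thesis using Np(2) b True by auto
    next
      case False
      obtain p' where p': "prime p'" "p' dvd b" using False prime_factor_nat by blast
      then have "p \<le> p'" using p_least b by simp
      also have "p' \<le> b" using p'(2) b0 by (rule dvd_imp_le)
      finally have pb: "real p \<le> real b" by simp
      have "b < m" using b b0 p2 by simp
      moreover have "real p'' \<le> Q" if "prime p''" "p'' dvd b" for p''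
        using less.prems(2) that b by simp
      ultimately obtain Nb where
        Nb: "real Nb \<le> real b * (C * sqrt Q + 4 * C - 4 * C / sqrt (real b))" "forces_zero_sum I b Nb"
        using less.IH[OF _ b0] by blast
      have "real (p * Nb + Np) \<le> real p * (real b * (C * sqrt Q + 4 * C - 4 * C / sqrt (real b))) +
        C * real p * sqrt (real p)"
        using mult_left_mono[OF Nb(1), of "real p"] Np(1) by simp
      also have "C * real p * sqrt (real p) \<le> real m * (C / sqrt (real b))"
      proof -
        have "C * real p * sqrt (real p) \<le> C * real p * sqrt (real b)"
          using pb C by (intro mult_left_mono) auto
        also have "\<dots> = real m * (C / sqrt (real b))"
          using b0 by (simp add: b field_simps)
        finally show ?thesis .
      qed
      also have "real p * (real b * (C * sqrt Q + 4 * C - 4 * C / sqrt (real b))) +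
          real m * (C / sqrt (real b)) =
        real m * (C * sqrt Q + 4 * C - 3 * C / sqrt (real b))"
        by (simp add: b algebra_simps)
      also have "\<dots> \<le> real m * (C * sqrt Q + 4 * C - 4 * C / sqrt (real m))"
      proof -
        \<comment> \<open>The reserve \<open>4 * C / sqrt b\<close> has paid the new error
          \<open>C / sqrt b\<close>. As \<open>sqrt p\<close> is at least \<open>4 / 3\<close>, the
          remaining \<open>3 * C / sqrt b\<close> still covers the reserve
          \<open>4 * C / sqrt m\<close>.\<close>
        have "4 / 3 = sqrt ((4 / 3)\<^sup>2)" by simp
        also have "\<dots> \<le> sqrt (real p)" using p2 by (intro real_sqrt_le_mono) (simp add: power2_eq_square)
        finally have "4 \<le> 3 * sqrt (real p)" by simp
        then have "4 * C \<le> 3 * sqrt (real p) * C" using C by (intro mult_right_mono) auto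
        then have "4 * C / sqrt (real m) \<le> 3 * C / sqrt (real b)"
          using b0 p2 by (simp add: b real_sqrt_mult field_simps)
        then show ?thesis by (intro mult_left_mono) auto
      qed
      finally have "real (p * Nb + Np) \<le> real m * (C * sqrt Q + 4 * C - 4 * C / sqrt (real m))" by simp
      moreover have "forces_zero_sum I m (p * Nb + Np)"
        unfolding b using Np(2) Nb(2) p2 by (intro forces_zero_sum_mult) auto
      ultimately show ?thesis by blast
    qed
  qed
qed

section \<open>Systems of congruences\<close>

text \<open>Block sums vanish modulo \<open>m\<close>, so only the \<open>p\<close>-parts
  \<open>gcd (d i) (p ^ k)\<close> of the moduli remain. Olson's theorem, applied to the block sums,
  selects blocks, and coprimality recombines the two divisibilities.\<close>

lemma system_zero_sum:
  fixes I :: "'i set" and J :: "nat set" and x :: "nat \<Rightarrow> 'i \<Rightarrow> int"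
  assumes p: "prime p" and cop: "coprime (p ^ k) m" and I: "finite I"
    and d: "\<And>i. i \<in> I \<Longrightarrow> d i dvd p ^ k * m"
    and forces: "forces_zero_sum I m N" and "m > 0"
    and J: "finite J" "m * Suc (\<Sum>i\<in>I. gcd (d i) (p ^ k) - 1) + N \<le> card J"
  shows "\<exists>T\<subseteq>J. T \<noteq> {} \<and> (\<forall>i\<in>I. int (d i) dvd (\<Sum>j\<in>T. x j i))"
proof -
  have "\<exists>e. gcd (d i) (p ^ k) = p ^ e" for i
    using divides_primepow_nat[OF p] by blast
  then obtain e where e: "\<And>i. gcd (d i) (p ^ k) = p ^ e i" by metis
  define M where "M = Suc (\<Sum>i\<in>I. p ^ e i - 1)"
  obtain B :: "nat \<Rightarrow> nat set" where disj: "disjoint_family_on B {..<M}"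
    and B: "\<And>t. t < M \<Longrightarrow> B t \<subseteq> J \<and> card (B t) = m \<and> (\<forall>i\<in>I. int m dvd (\<Sum>j\<in>B t. x j i))"
    using disjoint_zero_sum_blocks[OF forces J(1), of M x] J(2) unfolding e M_def by blast
  have "\<exists>S\<subseteq>{..<M}. S \<noteq> {} \<and> (\<forall>i\<in>I. int (p ^ e i) dvd (\<Sum>t\<in>S. \<Sum>j\<in>B t. x j i))"
    by (rule prime_power_zero_sum[OF p I]) (auto simp: M_def)
  then obtain S where S: "S \<subseteq> {..<M}" "S \<noteq> {}"
    and sum: "\<And>i. i \<in> I \<Longrightarrow> int (p ^ e i) dvd (\<Sum>t\<in>S. \<Sum>j\<in>B t. x j i)" by blast
  have BS: "B t \<subseteq> J" "card (B t) = m" "\<And>i. i \<in> I \<Longrightarrow> int m dvd (\<Sum>j\<in>B t. x j i)" if "t \<in> S" for t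
    using B[of t] S(1) that by blast+
  have finS: "finite S" using S(1) finite_subset by blast
  have finB: "\<forall>t\<in>S. finite (B t)" using BS(1) J(1) finite_subset by metis
  have disjS: "\<forall>s\<in>S. \<forall>t\<in>S. s \<noteq> t \<longrightarrow> B s \<inter> B t = {}"
    using disj S(1) unfolding disjoint_family_on_def by blast
  have "int (d i) dvd (\<Sum>j\<in>(\<Union>t\<in>S. B t). x j i)" if i: "i \<in> I" for i
  proof -
    have eq: "(\<Sum>j\<in>(\<Union>t\<in>S. B t). x j i) = (\<Sum>t\<in>S. \<Sum>j\<in>B t. x j i)"
      by (rule sum.UNION_disjoint[OF finS finB disjS])
    have "int m dvd (\<Sum>t\<in>S. \<Sum>j\<in>B t. x j i)" by (rule dvd_sum) (rule BS(3)[OF _ i])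
    moreover have "int (p ^ e i) dvd (\<Sum>t\<in>S. \<Sum>j\<in>B t. x j i)" by (rule sum[OF i])
    moreover have "coprime (int (p ^ e i)) (int m)"
    proof -
      have "coprime (p ^ e i) m"
        unfolding e[symmetric] by (rule coprime_divisors[OF gcd_dvd2 dvd_refl cop])
      then show ?thesis by (simp only: coprime_int_iff)
    qed
    ultimately have "int (p ^ e i) * int m dvd (\<Sum>t\<in>S. \<Sum>j\<in>B t. x j i)"
      by (intro divides_mult)
    \<comment> \<open>\<open>d i\<close> divides both \<open>d i * m\<close> and
      \<open>p ^ k * m\<close>, hence their gcd.\<close>
    moreover have "d i dvd p ^ e i * m"
      unfolding e[symmetric] using d[OF i] by (metis dvd_refl gcd_mult_distrib_nat gcd_greatest dvd_mult2 mult.commute dvd_triv_left)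
    ultimately show ?thesis unfolding eq
      by (metis dvd_trans int_dvd_int_iff of_nat_mult)
  qed
  moreover have "(\<Union>t\<in>S. B t) \<noteq> {}" using S(2) BS(2) \<open>m > 0\<close> by fastforce
  moreover have "(\<Union>t\<in>S. B t) \<subseteq> J" using BS(1) by blast
  ultimately show ?thesis by blast
qed

text \<open>Were all prime power components of \<open>n\<close> at most \<open>b\<close>, there
  would be at most \<open>b\<close> of them and \<open>n\<close> would not exceed
  \<open>b ^ b\<close>. Taking the largest component also bounds the primes of \<open>m\<close>, as
  \<open>forces_zero_sum_bound\<close> requires.\<close>

lemma large_prime_power_part:
  fixes n b :: nat
  assumes b: "b \<ge> 1" and n: "n > b ^ b"
  obtains p k m where "prime p" "n = p ^ k * m" "coprime (p ^ k) m" "p ^ k > b" "m > 0"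
    "\<And>p'. prime p' \<Longrightarrow> p' dvd m \<Longrightarrow> p' \<le> p ^ k"
proof -
  let ?P = "{p. prime p \<and> p dvd n}" and ?f = "\<lambda>p. p ^ multiplicity p n"
  have n0: "n > 0" using n by simp
  have P: "?P = prime_factors n" using n0 by (auto simp: prime_factors_dvd)
  have finP: "finite ?P" unfolding P by simp
  have "b ^ b \<ge> 1" using b by simp
  then have "n \<noteq> 1" using n by linarith
  then have "?P \<noteq> {}" using prime_factor_nat by blast
  then obtain p where p: "p \<in> ?P" "?f p = Max (?f ` ?P)"
    using Max_in[of "?f ` ?P"] finP by (metis (no_types, lifting) finite_imageI image_iff image_is_empty)
  have max: "?f p' \<le> ?f p" if "p' \<in> ?P" for p'
    unfolding p(2) using finP that by (intro Max_ge) auto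
  have le_f: "p' \<le> ?f p'" if "p' \<in> ?P" for p'
  proof -
    have "multiplicity p' n > 0" using that n0 by (simp add: prime_multiplicity_gt_zero_iff)
    then show ?thesis using that self_le_power[of p' "multiplicity p' n"] prime_ge_1_nat by auto
  qed
  have "?f p > b"
  proof (rule ccontr)
    assume "\<not> ?thesis"
    then have small: "?f p' \<le> b" if "p' \<in> ?P" for p' using max[OF that] by simp
    have "?P \<subseteq> {1..b}"
    proof
      fix p' assume p': "p' \<in> ?P"
      then have "1 \<le> p'" using prime_ge_1_nat[of p'] by auto
      then show "p' \<in> {1..b}" using le_trans[OF le_f[OF p'] small[OF p']] by simp
    qed
    then have "card ?P \<le> b" using card_mono[of "{1..b}" ?P] by simp
    have "n = (\<Prod>p'\<in>?P. ?f p')" unfolding P by (rule prime_factorization_nat[OF n0])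
    also have "\<dots> \<le> (\<Prod>p'\<in>?P. b)" using small by (intro prod_mono) auto
    also have "\<dots> = b ^ card ?P" by simp
    also have "\<dots> \<le> b ^ b" using \<open>card ?P \<le> b\<close> b by (intro power_increasing)
    finally show False using n by simp
  qed
  have np: "n \<noteq> 0" "\<not> is_unit p" using n0 p(1) not_prime_unit by auto
  obtain m where m: "n = ?f p * m" "\<not> p dvd m"
    using multiplicity_decompose'[OF np] by blast
  show thesis
  proof (rule that[of p "multiplicity p n" m])
    show "prime p" using p by simp
    show "n = ?f p * m" by (rule m)
    show "coprime (?f p) m" using p(1) m(2) prime_imp_coprime[of p m] by (simp add: coprime_power_left_iff)
    show "?f p > b" by fact
    show "m > 0" using m(1) n0 by (cases m) auto
    show "p' \<le> ?f p" if "prime p'" "p' dvd m" for p'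
    proof -
      have "p' \<in> ?P" using that m(1) by (metis dvd_mult mem_Collect_eq)
      then show ?thesis using le_f max le_trans by blast
    qed
  qed
qed

section \<open>Sequences over groups\<close>

lemma (in comm_monoid) seq_sum_superset:
  assumes "finite A" "set_mset S \<subseteq> A" "A \<subseteq> carrier G"
  shows "seq_sum G S = finprod G (\<lambda>x. x [^] count S x) A"
  unfolding seq_sum_def
  using assms by (intro finprod_mono_neutral_cong_left) (auto simp: not_in_iff)

lemma (in comm_monoid) seq_sum_add_mset:
  assumes "x \<in> carrier G" "set_mset S \<subseteq> carrier G"
  shows "seq_sum G (add_mset x S) = x \<otimes> seq_sum G S"
proof -
  let ?A = "insert x (set_mset S)"
  have A: "?A \<subseteq> carrier G" using assms by auto
  have "seq_sum G (add_mset x S) = finprod G (\<lambda>y. y [^] count (add_mset x S) y) ?A"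
    using A by (intro seq_sum_superset) auto
  also have "\<dots> = finprod G (\<lambda>y. (if y = x then y else \<one>) \<otimes> y [^] count S y) ?A"
    using A by (intro finprod_cong') (auto simp: subset_iff m_comm)
  also have "\<dots> = finprod G (\<lambda>y. if y = x then y else \<one>) ?A \<otimes> finprod G (\<lambda>y. y [^] count S y) ?A"
    using A by (intro finprod_multf) auto
  also have "finprod G (\<lambda>y. if y = x then y else \<one>) ?A = x"
    using A by (intro finprod_singleton_swap) auto
  also have "finprod G (\<lambda>y. y [^] count S y) ?A = seq_sum G S"
    using A by (intro seq_sum_superset[symmetric]) auto
  finally show ?thesis .
qed

lemma (in comm_monoid) seq_sum_empty: "seq_sum G {#} = \<one>"
  by (simp add: seq_sum_def)

text \<open>Divisible multiplicities kill the sum, whatever the shape of the group. This trades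
  \<open>L\<close> for a bounded number of congruences, one per element.\<close>

lemma (in comm_monoid) seq_sum_eq_one:
  assumes "set_mset S \<subseteq> carrier G" "\<And>x. x \<in> carrier G \<Longrightarrow> x [^] e = \<one>"
    and "\<And>x. x \<in># S \<Longrightarrow> e dvd count S x"
  shows "seq_sum G S = \<one>"
  unfolding seq_sum_def
proof (rule finprod_one_eqI)
  fix x assume x: "x \<in># S"
  then obtain c where "count S x = e * c" using assms(3) by auto
  then show "x [^] count S x = \<one>"
    using assms(1,2) x by (simp add: nat_pow_pow[symmetric] subset_iff)
qed

section \<open>Sums in direct products and in powers of cyclic groups\<close>

lemma comm_monoid_DirProd:
  "comm_monoid G \<Longrightarrow> comm_monoid H \<Longrightarrow> comm_monoid (G \<times>\<times> H)"
  by (intro comm_monoidI)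
    (auto simp: comm_monoid_def monoid.m_assoc monoid.m_closed comm_monoid_axioms_def)

lemma seq_sum_DirProd:
  assumes "comm_monoid G" "comm_monoid H" "set_mset S \<subseteq> carrier (G \<times>\<times> H)"
  shows "seq_sum (G \<times>\<times> H) S = (seq_sum G (image_mset fst S), seq_sum H (image_mset snd S))"
  using assms(3)
proof (induction S)
  case empty
  show ?case
    using comm_monoid.seq_sum_empty[OF assms(1)] comm_monoid.seq_sum_empty[OF assms(2)]
      comm_monoid.seq_sum_empty[OF comm_monoid_DirProd[OF assms(1,2)]] by simp
next
  case (add x S)
  interpret G: comm_monoid G by fact
  interpret H: comm_monoid H by fact
  interpret GH: comm_monoid "G \<times>\<times> H" by (rule comm_monoid_DirProd) fact+
  have "set_mset S \<subseteq> carrier G \<times> carrier H" "x \<in> carrier G \<times> carrier H" using add.prems by auto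
  then have "set_mset (image_mset fst S) \<subseteq> carrier G" "set_mset (image_mset snd S) \<subseteq> carrier H"
    "fst x \<in> carrier G" "snd x \<in> carrier H" by auto
  then show ?case
    using add GH.seq_sum_add_mset[of x S] G.seq_sum_add_mset[of "fst x" "image_mset fst S"]
      H.seq_sum_add_mset[of "snd x" "image_mset snd S"]
    by (cases x) auto
qed

lemma comm_monoid_cyclic_power: "comm_monoid (cyclic_power n r)"
proof -
  interpret group "cyclic_power n r" unfolding cyclic_power_def by (rule product_group) simp
  show ?thesis
    by unfold_locales (auto simp: cyclic_power_def add.commute)
qed

lemma carrier_cyclic_power: "n > 0 \<Longrightarrow> carrier (cyclic_power n r) = PiE {..<r} (\<lambda>_. {0..<int n})"
  by (simp add: cyclic_power_def carrier_integer_mod_group)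

lemma seq_sum_cyclic_power:
  assumes "n > 0" "set_mset S \<subseteq> carrier (cyclic_power n r)"
  shows "seq_sum (cyclic_power n r) S = (\<lambda>i\<in>{..<r}. (\<Sum>c\<in>#S. c i) mod int n)"
  using assms(2)
proof (induction S)
  case empty
  show ?case
    using comm_monoid.seq_sum_empty[OF comm_monoid_cyclic_power, of n r]
    by (auto simp: cyclic_power_def)
next
  case (add x S)
  interpret comm_monoid "cyclic_power n r" by (rule comm_monoid_cyclic_power)
  have "seq_sum (cyclic_power n r) (add_mset x S) =
      x \<otimes>\<^bsub>cyclic_power n r\<^esub> (\<lambda>i\<in>{..<r}. (\<Sum>c\<in>#S. c i) mod int n)"
    using add.prems by (subst seq_sum_add_mset) (simp_all only: add.IH set_mset_add_mset_insert insert_subset)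
  also have "\<dots> = (\<lambda>i\<in>{..<r}. (\<Sum>c\<in>#add_mset x S. c i) mod int n)"
    by (auto simp: cyclic_power_def mod_simps intro!: restrict_ext)
  finally show ?case .
qed

lemma zero_sum_DirProd_cyclic_power_iff:
  assumes "comm_monoid L" "n > 0" "set_mset S \<subseteq> carrier (L \<times>\<times> cyclic_power n r)"
  shows "zero_sum (L \<times>\<times> cyclic_power n r) S \<longleftrightarrow>
    zero_sum L (image_mset fst S) \<and> (\<forall>i<r. int n dvd (\<Sum>c\<in>#S. snd c i))"
proof -
  have "set_mset (image_mset snd S) \<subseteq> carrier (cyclic_power n r)" using assms(3) by auto
  then have "seq_sum (cyclic_power n r) (image_mset snd S) =
      (\<lambda>i\<in>{..<r}. (\<Sum>c\<in>#S. snd c i) mod int n)"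
    by (simp add: seq_sum_cyclic_power[OF assms(2)] image_mset.compositionality comp_def)
  moreover have "(\<lambda>i\<in>{..<r}. (\<Sum>c\<in>#S. snd c i) mod int n) = (\<lambda>i\<in>{..<r}. 0) \<longleftrightarrow>
      (\<forall>i<r. int n dvd (\<Sum>c\<in>#S. snd c i))"
    by (auto simp: fun_eq_iff restrict_def dvd_eq_mod_eq_0)
  ultimately show ?thesis
    unfolding zero_sum_def
    by (simp add: seq_sum_DirProd[OF assms(1) comm_monoid_cyclic_power assms(3)])
      (simp add: cyclic_power_def)
qed

text \<open>The order of the group is a valid exponent, so the \<open>LEAST\<close> is
  attained.\<close>

lemma group_exponent:
  assumes "comm_group L" "finite (carrier L)"
  shows "group_exponent L \<ge> 1" "x \<in> carrier L \<Longrightarrow> x [^]\<^bsub>L\<^esub> group_exponent L = \<one>\<^bsub>L\<^esub>"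
proof -
  interpret comm_group L by fact
  have "order L \<ge> 1 \<and> (\<forall>x\<in>carrier L. x [^]\<^bsub>L\<^esub> order L = \<one>\<^bsub>L\<^esub>)"
    using assms(2) order_gt_0_iff_finite pow_order_eq_1 by auto
  from LeastI[of "\<lambda>e. e \<ge> 1 \<and> (\<forall>x\<in>carrier L. x [^]\<^bsub>L\<^esub> e = \<one>\<^bsub>L\<^esub>)", OF this]
  show "group_exponent L \<ge> 1" "x \<in> carrier L \<Longrightarrow> x [^]\<^bsub>L\<^esub> group_exponent L = \<one>\<^bsub>L\<^esub>"
    unfolding group_exponent_def by auto
qed

section \<open>Upper and lower bounds for the Davenport constant\<close>

lemma davenport_le:
  assumes "t \<ge> 1" "\<And>S. set_mset S \<subseteq> carrier G \<Longrightarrow> t \<le> size S \<Longrightarrow>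
    \<exists>T. T \<subseteq># S \<and> T \<noteq> {#} \<and> zero_sum G T"
  shows "davenport G \<le> t"
  unfolding davenport_def using assms by (intro Least_le) blast

text \<open>The bound \<open>t\<close> shows that the \<open>LEAST\<close> is attained, so
  \<open>davenport G\<close> itself has the defining property, which \<open>S\<close> violates at
  its own length.\<close>

lemma less_davenport:
  assumes t: "t \<ge> 1" "\<And>S. set_mset S \<subseteq> carrier G \<Longrightarrow> t \<le> size S \<Longrightarrow>
    \<exists>T. T \<subseteq># S \<and> T \<noteq> {#} \<and> zero_sum G T"
    and S: "set_mset S \<subseteq> carrier G" "\<And>T. T \<subseteq># S \<Longrightarrow> zero_sum G T \<Longrightarrow> T = {#}"
  shows "size S < davenport G"
proof -
  let ?P = "\<lambda>t. t \<ge> 1 \<and> (\<forall>S. set_mset S \<subseteq> carrier G \<and> size S \<ge> t \<longrightarrow>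
        (\<exists>T. T \<subseteq># S \<and> T \<noteq> {#} \<and> zero_sum G T))"
  have "?P t" using t by blast
  then have "?P (davenport G)" unfolding davenport_def by (rule LeastI)
  then show ?thesis using S by (meson not_less)
qed

lemma count_image_mset_mset_set:
  "finite T \<Longrightarrow> int (count (image_mset g (mset_set T)) l) = (\<Sum>j\<in>T. of_bool (g j = l))"
  by (induction T rule: finite_induct) auto

text \<open>The sequence is encoded by integer vectors with one coordinate per element \<open>l\<close> of \<open>L\<close>,
  counting occurrences of \<open>l\<close> modulo the exponent, and one per cyclic factor modulo \<open>n\<close>.\<close>

lemma zero_sum_subsequence_exists:
  fixes L :: "('a, 'b) monoid_scheme"
  assumes L: "comm_group L" "finite (carrier L)"
    and n: "group_exponent L dvd n" "n = p ^ k * m" "m > 0" and p: "prime p" "coprime (p ^ k) m"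
    and forces: "forces_zero_sum (carrier L <+> {..<r}) m N"
    and S: "set_mset S \<subseteq> carrier (L \<times>\<times> cyclic_power n r)"
      "m * (card (carrier L) * group_exponent L + r * p ^ k + 1) + N \<le> size S"
  shows "\<exists>T. T \<subseteq># S \<and> T \<noteq> {#} \<and> zero_sum (L \<times>\<times> cyclic_power n r) T"
proof -
  interpret comm_group L by fact
  define e where "e = group_exponent L"
  let ?I = "carrier L <+> {..<r}" and ?q = "p ^ k"
  define d :: "'a + nat \<Rightarrow> nat" where "d = case_sum (\<lambda>_. e) (\<lambda>_. n)"
  have n0: "n > 0" using n(2,3) prime_gt_0_nat[OF p(1)] by simp
  have e1: "e \<ge> 1" using group_exponent(1)[OF L] by (simp add: e_def)
  obtain xs where xs: "mset xs = S" using ex_mset by blast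
  define x :: "nat \<Rightarrow> 'a + nat \<Rightarrow> int" where
    "x = (\<lambda>j. case_sum (\<lambda>l. of_bool (fst (xs ! j) = l)) (\<lambda>i. snd (xs ! j) i))"
  \<comment> \<open>The coordinates from \<open>L\<close> contribute an amount bounded independently
    of \<open>n\<close>, the cyclic ones at most \<open>p ^ k\<close> each.\<close>
  have "(\<Sum>i\<in>?I. gcd (d i) ?q - 1) = (\<Sum>l\<in>carrier L. gcd e ?q - 1) + (\<Sum>i<r. gcd n ?q - 1)"
    unfolding Plus_def using L(2) by (subst sum.union_disjoint) (auto simp: sum.reindex d_def)
  also have "\<dots> \<le> card (carrier L) * e + r * ?q"
  proof -
    have "gcd e ?q \<le> e" "gcd n ?q \<le> ?q" using e1 prime_gt_0_nat[OF p(1)] by (auto intro: dvd_imp_le)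
    then show ?thesis by (auto intro!: add_mono mult_le_mono2)
  qed
  finally have "m * Suc (\<Sum>i\<in>?I. gcd (d i) ?q - 1) \<le> m * (card (carrier L) * e + r * ?q + 1)"
    by (intro mult_le_mono2) simp
  then have "m * Suc (\<Sum>i\<in>?I. gcd (d i) ?q - 1) + N \<le>
      m * (card (carrier L) * e + r * ?q + 1) + N" by (rule add_right_mono)
  also have "\<dots> \<le> size S" using S(2) by (simp only: e_def)
  also have "size S = card {..<length xs}" using xs by auto
  finally have card: "m * Suc (\<Sum>i\<in>?I. gcd (d i) ?q - 1) + N \<le> card {..<length xs}" .
  have "\<exists>T\<subseteq>{..<length xs}. T \<noteq> {} \<and> (\<forall>i\<in>?I. int (d i) dvd (\<Sum>j\<in>T. x j i))"
    by (rule system_zero_sum[OF p _ _ forces n(3) _ card])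
      (use L(2) n in \<open>auto simp: d_def e_def split: sum.splits\<close>)
  then obtain T where T: "T \<subseteq> {..<length xs}" "T \<noteq> {}"
    and sum: "\<And>i. i \<in> ?I \<Longrightarrow> int (d i) dvd (\<Sum>j\<in>T. x j i)" by blast
  have finT: "finite T" using T(1) finite_subset by blast
  define M where "M = image_mset ((!) xs) (mset_set T)"
  have "M \<subseteq># image_mset ((!) xs) (mset_set {..<length xs})"
    unfolding M_def using T(1) by (intro image_mset_subseteq_mono subset_imp_msubset_mset_set) auto
  also have "\<dots> = S"
    unfolding xs[symmetric] by (metis lessThan_atLeast0 map_nth mset_map mset_upt)
  finally have MS: "M \<subseteq># S" .
  have MG: "set_mset M \<subseteq> carrier (L \<times>\<times> cyclic_power n r)" using set_mset_mono[OF MS] S(1) by blast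
  have "zero_sum L (image_mset fst M)"
    unfolding zero_sum_def
  proof (rule seq_sum_eq_one)
    show fstM: "set_mset (image_mset fst M) \<subseteq> carrier L" using MG by auto
    show "y [^]\<^bsub>L\<^esub> e = \<one>\<^bsub>L\<^esub>" if "y \<in> carrier L" for y
      using group_exponent(2)[OF L that] by (simp add: e_def)
    fix l assume "l \<in># image_mset fst M"
    then have "l \<in> carrier L" using fstM by blast
    then have "int e dvd (\<Sum>j\<in>T. of_bool (fst (xs ! j) = l))"
      using sum[of "Inl l"] by (auto simp: d_def x_def)
    also have "\<dots> = int (count (image_mset fst M) l)"
      unfolding M_def image_mset.compositionality count_image_mset_mset_set[OF finT] by simp
    finally show "e dvd count (image_mset fst M) l" by (simp only: int_dvd_int_iff)
  qed
  moreover have "int n dvd (\<Sum>c\<in>#M. snd c i)" if "i < r" for i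
    using sum[of "Inr i"] that
    by (auto simp: d_def x_def M_def image_mset.compositionality comp_def sum_unfold_sum_mset)
  ultimately have "zero_sum (L \<times>\<times> cyclic_power n r) M"
    using zero_sum_DirProd_cyclic_power_iff[OF comm_monoid_axioms n0 MG] by blast
  moreover have "M \<noteq> {#}" using T(2) finT by (simp add: M_def mset_set_empty_iff)
  ultimately show ?thesis using MS by blast
qed

text \<open>Coordinate \<open>i\<close> of a subsum is the multiplicity of the \<open>i\<close>-th
  basis element, which is below \<open>n\<close> and thus divisible by \<open>n\<close> only when
  zero.\<close>

lemma zero_sum_free_sequence:
  fixes L :: "('a, 'b) monoid_scheme"
  assumes L: "comm_group L" and n: "n \<ge> 2"
  obtains S where "set_mset S \<subseteq> carrier (L \<times>\<times> cyclic_power n r)" "size S = r * (n - 1)"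
    "\<And>T. T \<subseteq># S \<Longrightarrow> zero_sum (L \<times>\<times> cyclic_power n r) T \<Longrightarrow> T = {#}"
proof -
  interpret comm_group L by fact
  define g :: "nat \<Rightarrow> 'a \<times> (nat \<Rightarrow> int)" where
    "g = (\<lambda>i. (\<one>\<^bsub>L\<^esub>, \<lambda>j\<in>{..<r}. of_bool (i = j)))"
  define S where "S = (\<Sum>i<r. replicate_mset (n - 1) (g i))"
  have inj: "inj_on g {..<r}"
    by (auto simp: g_def inj_on_def fun_eq_iff restrict_def of_bool_def split: if_splits)
  have gG: "g i \<in> carrier (L \<times>\<times> cyclic_power n r)" for i
    using n by (auto simp: g_def carrier_cyclic_power)
  have setS: "set_mset S \<subseteq> g ` {..<r}"
    by (auto simp: S_def set_mset_sum)
  have countS: "count S (g i) = n - 1" if "i < r" for i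
  proof -
    have "count S (g i) = (\<Sum>j<r. count (replicate_mset (n - 1) (g j)) (g i))"
      by (simp add: S_def count_sum)
    also have "\<dots> = (\<Sum>j<r. if j = i then n - 1 else 0)"
      using inj that by (intro sum.cong) (auto simp: inj_on_def)
    also have "\<dots> = n - 1" using that by simp
    finally show ?thesis .
  qed
  have coordinate: "(\<Sum>c\<in>#T. snd c i) = int (count T (g i))"
    if "set_mset T \<subseteq> g ` {..<r}" "i < r" for T i
    using that
  proof (induction T)
    case (add c T)
    then obtain j where j: "j < r" "c = g j" by auto
    have "snd (g j) i = of_bool (g j = g i)"
      using inj j(1) add.prems(2) by (auto simp: g_def inj_on_def)
    then show ?case using add j by auto
  qed simp
  show thesis
  proof (rule that[of S])
    show SG: "set_mset S \<subseteq> carrier (L \<times>\<times> cyclic_power n r)" using setS gG by blast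
    show "size S = r * (n - 1)" by (simp add: S_def size_multiset_sum)
    fix T assume T: "T \<subseteq># S" "zero_sum (L \<times>\<times> cyclic_power n r) T"
    have setT: "set_mset T \<subseteq> set_mset S" using T(1) by (rule set_mset_mono)
    have "count T (g i) = 0" if i: "i < r" for i
    proof -
      have TG: "set_mset T \<subseteq> carrier (L \<times>\<times> cyclic_power n r)" using setT SG by (rule order_trans)
      have "n > 0" using n by simp
      from zero_sum_DirProd_cyclic_power_iff[OF comm_monoid_axioms this TG] T(2) i
      have "int n dvd (\<Sum>c\<in>#T. snd c i)" by blast
      also have "\<dots> = int (count T (g i))" using setT setS i by (intro coordinate) blast
      finally have "int n dvd int (count T (g i))" .
      moreover have "count T (g i) < n"
        using mset_subset_eq_count[OF T(1), of "g i"] countS[OF i] n by linarith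
      ultimately show ?thesis by (simp add: int_dvd_int_iff) (metis dvd_imp_le neq0_conv not_less)
    qed
    then have "c \<notin># T" for c using setT setS by (fastforce simp: count_eq_zero_iff)
    then show "T = {#}" by (simp add: multiset_eq_iff not_in_iff)
  qed
qed

section \<open>Asymptotics\<close>

text \<open>With \<open>n = q * m\<close> and \<open>q = p ^ k > b\<close>, the terms beyond
  \<open>r * n\<close> number at most \<open>D * m * sqrt q\<close>, which is
  \<open>n * D / sqrt q\<close>. \<open>D\<close> is chosen before \<open>b\<close> and
  \<open>n\<close>, so \<open>b\<close> stays free to make the error small.\<close>

lemma davenport_bounds:
  fixes L :: "('a, 'b) monoid_scheme"
  assumes L: "comm_group L" "finite (carrier L)"
  shows "\<exists>D\<ge>0. \<forall>b\<ge>1. \<forall>n. b ^ b < n \<and> group_exponent L dvd n \<longrightarrow>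
    real r * (real n - 1) < real (davenport (L \<times>\<times> cyclic_power n r)) \<and>
    real (davenport (L \<times>\<times> cyclic_power n r)) \<le> real n * (real r + D / sqrt (real b))"
proof -
  define e where "e = real (group_exponent L)"
  let ?I = "carrier L <+> {..<r}"
  have "finite ?I" using L(2) by simp
  from forces_zero_sum_prime_bound[OF this]
  obtain C where C: "C \<ge> 1" "\<And>p. prime p \<Longrightarrow>
      \<exists>N. real N \<le> C * real p * sqrt (real p) \<and> forces_zero_sum ?I p N" by blast
  \<comment> \<open>\<open>5 * C\<close> combines the coefficient \<open>C\<close> of
    \<open>sqrt q\<close> with the constant \<open>4 * C\<close>, which is absorbed because
    \<open>sqrt q\<close> is at least \<open>1\<close>.\<close>
  define D where "D = real (card (carrier L)) * e + 1 + 5 * C"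
  have D0: "D \<ge> 0" using C(1) by (simp add: D_def e_def)
  have "real r * (real n - 1) < real (davenport (L \<times>\<times> cyclic_power n r)) \<and>
    real (davenport (L \<times>\<times> cyclic_power n r)) \<le> real n * (real r + D / sqrt (real b))"
    if b: "b \<ge> 1" and n: "b ^ b < n" "group_exponent L dvd n" for b n
  proof -
    obtain p k m where p: "prime p" and n_eq: "n = p ^ k * m" and cop: "coprime (p ^ k) m"
      and q: "p ^ k > b" and m: "m > 0" and primes: "\<And>p'. prime p' \<Longrightarrow> p' dvd m \<Longrightarrow> p' \<le> p ^ k"
      using large_prime_power_part[OF b n(1)] by metis
    let ?q = "real (p ^ k)"
    have q1: "?q \<ge> 1" and qb: "real b \<le> ?q" using q b by linarith+
    obtain N where N: "real N \<le> real m * (C * sqrt ?q + 4 * C - 4 * C / sqrt (real m))"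
      and forces: "forces_zero_sum ?I m N"
      using forces_zero_sum_bound[OF C q1 m] primes by (auto simp: of_nat_le_iff simp del: of_nat_power)
    define t where "t = m * (card (carrier L) * group_exponent L + r * p ^ k + 1) + N"
    have t1: "t \<ge> 1" using m by (simp add: t_def)
    have zs: "\<exists>T. T \<subseteq># S \<and> T \<noteq> {#} \<and> zero_sum (L \<times>\<times> cyclic_power n r) T"
      if "set_mset S \<subseteq> carrier (L \<times>\<times> cyclic_power n r)" "t \<le> size S" for S
      using zero_sum_subsequence_exists[OF L n(2) n_eq m p cop forces that(1)] that(2)
      unfolding t_def by blast
    have "1 \<le> b ^ b" using b by simp
    then have n2: "n \<ge> 2" using n(1) by linarith
    obtain S where S: "set_mset S \<subseteq> carrier (L \<times>\<times> cyclic_power n r)" "size S = r * (n - 1)"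
      "\<And>T. T \<subseteq># S \<Longrightarrow> zero_sum (L \<times>\<times> cyclic_power n r) T \<Longrightarrow> T = {#}"
      using zero_sum_free_sequence[OF L(1) n2] by blast
    have "size S < davenport (L \<times>\<times> cyclic_power n r)"
      using less_davenport[OF t1 zs S(1,3)] by blast
    then have "real (r * (n - 1)) < real (davenport (L \<times>\<times> cyclic_power n r))"
      unfolding S(2) of_nat_less_iff .
    then have lower: "real r * (real n - 1) < real (davenport (L \<times>\<times> cyclic_power n r))"
      using n2 by (simp add: of_nat_diff)
    have "davenport (L \<times>\<times> cyclic_power n r) \<le> t" using davenport_le[OF t1 zs] by blast
    then have "real (davenport (L \<times>\<times> cyclic_power n r)) \<le> real t" by (simp only: of_nat_le_iff)
    also have "\<dots> \<le> real m * (real (card (carrier L)) * e + real r * ?q + 1) +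
        real m * (C * sqrt ?q + 4 * C)"
    proof -
      have "real m * (C * sqrt ?q + 4 * C - 4 * C / sqrt (real m)) \<le> real m * (C * sqrt ?q + 4 * C)"
        using C(1) by (intro mult_left_mono) auto
      with N have "real N \<le> real m * (C * sqrt ?q + 4 * C)" by linarith
      then show ?thesis
        unfolding t_def e_def of_nat_add of_nat_mult of_nat_1 by (intro add_mono order_refl)
    qed
    also have "\<dots> \<le> real m * (real r * ?q + D * sqrt ?q)"
    proof -
      have "(real (card (carrier L)) * e + 1 + 4 * C) * 1 \<le>
          (real (card (carrier L)) * e + 1 + 4 * C) * sqrt ?q"
        using q1 C(1) by (intro mult_left_mono) (auto simp: e_def simp del: of_nat_power)
      then have "real (card (carrier L)) * e + real r * ?q + 1 + (C * sqrt ?q + 4 * C) \<le>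
          real r * ?q + D * sqrt ?q"
        unfolding D_def by (simp only: distrib_right mult_1_right)
      then show ?thesis
        unfolding distrib_left[symmetric] by (intro mult_left_mono of_nat_0_le_iff)
    qed
    also have "\<dots> = real n * (real r + D / sqrt ?q)"
    proof -
      have "sqrt ?q = ?q / sqrt ?q" by (rule real_div_sqrt[symmetric]) simp
      from arg_cong[OF this, of "(*) D"] have "D * sqrt ?q = ?q * (D / sqrt ?q)"
        by (simp only: times_divide_eq_right mult.commute)
      then have "real m * (real r * ?q + D * sqrt ?q) = (?q * real m) * (real r + D / sqrt ?q)"
        by (simp only: algebra_simps)
      then show ?thesis by (simp add: n_eq)
    qed
    also have "\<dots> \<le> real n * (real r + D / sqrt (real b))"
    proof -
      have "sqrt (real b) \<le> sqrt ?q" using qb by (rule real_sqrt_le_mono)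
      then have "D / sqrt ?q \<le> D / sqrt (real b)"
        using D0 b prime_gt_0_nat[OF p] by (intro divide_left_mono mult_pos_pos) auto
      then show ?thesis by (intro mult_left_mono add_left_mono) auto
    qed
    finally show ?thesis using lower by blast
  qed
  with D0 show ?thesis by blast
qed

theorem theorem5:
  fixes L :: "('a, 'b) monoid_scheme" and r :: nat
  assumes "comm_group L" and "finite (carrier L)" and "r \<ge> 1"
  shows "((\<lambda>n. real (davenport (L \<times>\<times> cyclic_power n r)) / (real r * real n)) \<longlongrightarrow> 1)
           (inf at_top (principal {n. n \<ge> 1 \<and> group_exponent L dvd n}))"
proof (rule tendstoI)
  fix \<epsilon> :: real assume \<epsilon>: "\<epsilon> > 0"
  obtain D where D: "D \<ge> 0" and bounds: "\<And>b n. b \<ge> 1 \<Longrightarrow> b ^ b < n \<Longrightarrow> group_exponent L dvd n \<Longrightarrow>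
    real r * (real n - 1) < real (davenport (L \<times>\<times> cyclic_power n r)) \<and>
    real (davenport (L \<times>\<times> cyclic_power n r)) \<le> real n * (real r + D / sqrt (real b))"
    using davenport_bounds[OF assms(1,2), of r] by blast
  \<comment> \<open>\<open>b\<close> makes the upper error \<open>D / sqrt b\<close> smaller than
    \<open>\<epsilon>\<close>; the lower bound loses only \<open>1 / n\<close> relatively, which
    \<open>c\<close> controls.\<close>
  obtain b :: nat where b: "real b > max 1 ((D / \<epsilon>)\<^sup>2)" using reals_Archimedean2 by blast
  have "D / \<epsilon> < sqrt (real b)" using b by (intro real_less_rsqrt) simp
  then have D_small: "D / sqrt (real b) < \<epsilon>"
    using \<epsilon> b by (simp add: field_simps)
  obtain c :: nat where c: "real c > 1 / \<epsilon>" using reals_Archimedean2 by blast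
  show "\<forall>\<^sub>F n in inf at_top (principal {n. n \<ge> 1 \<and> group_exponent L dvd n}).
      dist (real (davenport (L \<times>\<times> cyclic_power n r)) / (real r * real n)) 1 < \<epsilon>"
    unfolding eventually_inf_principal
  proof (rule eventually_mono[OF eventually_gt_at_top[of "max (b ^ b) c"]], intro impI)
    fix n assume n: "max (b ^ b) c < n" "n \<in> {n. n \<ge> 1 \<and> group_exponent L dvd n}"
    let ?d = "real (davenport (L \<times>\<times> cyclic_power n r))"
    have lower: "real r * (real n - 1) < ?d" and upper: "?d \<le> real n * (real r + D / sqrt (real b))"
      using bounds[of b n] b n by auto
    have r: "real r \<ge> 1" using assms(3) by simp
    have n0: "real n > 0" using n(2) by simp
    have rn: "real r * real n > 0" using r n0 by simp
    have "1 / \<epsilon> < real n" using c n(1) by simp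
    then have "1 < \<epsilon> * real n" using \<epsilon> by (simp add: field_simps)
    then have "real r * 1 < real r * (\<epsilon> * real n)" using r by (intro mult_strict_left_mono) auto
    then have "(1 - \<epsilon>) * (real r * real n) < ?d" using lower by (simp add: algebra_simps)
    then have 1: "1 - \<epsilon> < ?d / (real r * real n)" using rn by (simp add: pos_less_divide_eq)
    have "\<epsilon> \<le> real r * \<epsilon>" using r \<epsilon> by simp
    then have "D / sqrt (real b) < real r * \<epsilon>" using D_small by linarith
    then have "real n * (real r + D / sqrt (real b)) < real n * (real r + real r * \<epsilon>)"
      using n0 by (intro mult_strict_left_mono add_strict_left_mono)
    then have "?d < (1 + \<epsilon>) * (real r * real n)" using upper by (simp add: algebra_simps)
    then have 2: "?d / (real r * real n) < 1 + \<epsilon>" using rn by (simp add: pos_divide_less_eq)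
    show "dist (?d / (real r * real n)) 1 < \<epsilon>"
      using 1 2 by (simp add: dist_real_def abs_less_iff)
  qed
qed

end
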